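(* There is an absolute constant $c_1>0$ with the following property. Let $Q,N\in\mathbb{N}$, let $(a_n)_{n\in\mathbb{Z}[i]}$ be any sequence of complex numbers, put $Z=\sum_{n\in\mathbb{Z}[i],\ \mathcal{N}(n)\le N}|a_n|^2$, and let $\mathcal{S}\subseteq B(0,Q^{1/2})\cap(\mathbb{Z}[i]\setminus\{0\})$. Then $$\sum_{q\in\mathcal{S}}\ \sum_{\substack{a\bmod q\\ (a,q)=1}}\Big|\sum_{\substack{n\in\mathbb{Z}[i]\\ \mathcal{N}(n)\le N}} a_n\, e\Big(\Re\Big(\frac{na}{q}\Big)\Big)\Big|^2 \le c_1 N Z\left(1+\sup_{\substack{r\in\mathbb{Z}[i]\setminus\{0\}\\ 1\le|r|\le N^{1/4}}}\ \sup_{\substack{z\in\mathbb{C}\\ N^{-1/2}\le|z|\le \frac{2}{|r|N^{1/4}}}}\ \sup_{\substack{h\in\mathbb{Z}[i]\\ (h,r)=1}}\ \sum_{t\mid r}\ \sum_{\substack{m\in\mathbb{Z}[i],\ 0<|m|\le \frac{3|rz|\sqrt{Q}}{|t|}\\ (m,\frac{r}{t})=1}} A_t\Big(\frac{\sqrt{Q}}{\sqrt{N}\,|zt|},\frac{r}{t},hm\Big)\right).$$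
   Context: $e(x)=e^{2\pi i x}$. $\mathbb{Z}[i]$ denotes the Gaussian integers and $\mathcal{N}(q)=\Re(q)^2+\Im(q)^2$ the norm. For $y\in\mathbb{C}$, $u\ge 0$, $B(y,u)=\{w\in\mathbb{C}:|w-y|\le u\}$. "$a\bmod q$, $(a,q)=1$" means $a$ runs over a complete system of residues modulo $q$ in $\mathbb{Z}[i]$ coprime to $q$. The sum over $t\mid r$ runs over a maximal set of mutually non-associate divisors $t$ of $r$ in $\mathbb{Z}[i]$. For $t\in\mathbb{Z}[i]\setminus\{0\}$, $\mathcal{S}_t=\{q\in\mathbb{Z}[i]: tq\in\mathcal{S}\}$, and for $u\ge0$, $k\in\mathbb{Z}[i]\setminus\{0\}$, $l\in\mathbb{Z}[i]$, $$A_t(u,k,l)=\sup_{y\in\mathbb{C},\ |y|\le \sqrt{Q}/|t|}\big|\{q\in\mathcal{S}_t\cap B(y,u): q\equiv l \bmod k\}\big|.$$ *)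

theory Defs
  imports "HOL-Analysis.Analysis"
begin

definition gauss :: "complex set" where
  "gauss = {z. Re z \<in> \<int> \<and> Im z \<in> \<int>}"

definition gnorm :: "complex \<Rightarrow> real" where
  "gnorm z = (Re z)^2 + (Im z)^2"

definition e :: "real \<Rightarrow> complex" where
  "e x = exp (2 * pi * \<i> * complex_of_real x)"

definition gdvd :: "complex \<Rightarrow> complex \<Rightarrow> bool" where
  "gdvd d x \<longleftrightarrow> d \<in> gauss \<and> x \<in> gauss \<and> (\<exists>k\<in>gauss. x = d * k)"

definition gunit :: "complex \<Rightarrow> bool" where
  "gunit u \<longleftrightarrow> gdvd u 1"

definition gcoprime :: "complex \<Rightarrow> complex \<Rightarrow> bool" where
  "gcoprime x y \<longleftrightarrow> (\<forall>d. gdvd d x \<and> gdvd d y \<longrightarrow> gunit d)"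

definition gcong :: "complex \<Rightarrow> complex \<Rightarrow> complex \<Rightarrow> bool" where
  "gcong x y k \<longleftrightarrow> gdvd k (x - y)"

definition gassoc :: "complex \<Rightarrow> complex \<Rightarrow> bool" where
  "gassoc t s \<longleftrightarrow> (\<exists>u. gunit u \<and> s = u * t)"

definition reduced_residue_system :: "complex \<Rightarrow> complex set \<Rightarrow> bool" where
  "reduced_residue_system q R \<longleftrightarrow>
     R \<subseteq> gauss \<and> (\<forall>x\<in>R. gcoprime x q) \<and>
     (\<forall>x\<in>R. \<forall>y\<in>R. gcong x y q \<longrightarrow> x = y) \<and>
     (\<forall>x\<in>gauss. gcoprime x q \<longrightarrow> (\<exists>y\<in>R. gcong x y q))"

definition divisor_system :: "complex \<Rightarrow> complex set \<Rightarrow> bool" where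
  "divisor_system r D \<longleftrightarrow>
     D \<subseteq> {t. gdvd t r} \<and>
     (\<forall>t\<in>D. \<forall>s\<in>D. gassoc t s \<longrightarrow> t = s) \<and>
     (\<forall>t. gdvd t r \<longrightarrow> (\<exists>s\<in>D. gassoc t s))"

definition Sdiv :: "complex set \<Rightarrow> complex \<Rightarrow> complex set" where
  "Sdiv S t = {q\<in>gauss. t * q \<in> S}"

definition A_cnt :: "nat \<Rightarrow> complex set \<Rightarrow> complex \<Rightarrow> real \<Rightarrow> complex \<Rightarrow> complex \<Rightarrow> real" where
  "A_cnt Q S t u k l =
     (SUP y\<in>{y. cmod y \<le> sqrt (real Q) / cmod t}.
        real (card {q \<in> Sdiv S t \<inter> cball y u. gcong q l k}))"

end

theory Submission
  imports Defs
begin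

text \<open>A frequency \<open>n\<close> with \<open>gnorm n \<le> N\<close> has coordinates of size
  at most \<open>sqrt N\<close>, so \<open>N^(-1/2)\<close> is the natural resolution for the points
  \<open>a / q\<close>. The Fejer kernel enters without any Fourier analysis: with \<open>s\<close>
  the integer part of \<open>sqrt N\<close>, each admissible \<open>n\<close> is a difference of
  points of a square grid of side \<open>4 * s\<close> in at least \<open>(2 * s)^2\<close> ways,
  and the sum over all differences factors into geometric sums. The shape of the right-hand side
  dictates the constants. The range of \<open>z\<close> ends at \<open>2 / (|r| * N^(1/4))\<close>,
  so the approximation step must deliver exactly the constant 2. It begins at
  \<open>N^(-1/2)\<close>, so a centre too close to \<open>b / r\<close> has to be traded for points
  on that circle; this works as long as the counted disc has radius at most
  \<open>2/5 * N^(-1/2)\<close>, because \<open>1 + 2/5 < sqrt 2\<close>. The fractions equal to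
  \<open>b / r\<close> itself account for the 1 added to the supremum. The suprema are taken in the
  reals, where they say nothing unless the family is nonempty and bounded above; a crude bound
  independent of \<open>r\<close>, \<open>z\<close> and \<open>h\<close> is therefore proved as
  well.\<close>

text \<open>
  By duality and positivity of the Fejer kernel, the left-hand side is \<open>O(N Z K)\<close>, where \<open>K\<close> bounds the number of
  reduced fractions \<open>a/q\<close> with \<open>q \<in> S\<close> in a disc of radius a small multiple of \<open>N\<^sup>-\<^sup>1\<^sup>/\<^sup>2\<close> around any \<open>\<alpha>\<close>.
  Write \<open>\<alpha> = b/r + z\<close> by Dirichlet approximation. For a fraction \<open>a/q\<close> in the disc put \<open>t = gcd(r, q)\<close> and
  \<open>t m = a r - b q\<close>. The case \<open>m = 0\<close> occurs for at most four pairs \<open>(q, a)\<close>; otherwise \<open>q/t\<close> lies in a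
  fixed residue class modulo \<open>r/t\<close> determined by \<open>m\<close> and close to \<open>m/(r z)\<close>, so these pairs are counted by \<open>A_cnt\<close>.
  If \<open>|z| < N\<^sup>-\<^sup>1\<^sup>/\<^sup>2\<close>, the disc is first covered by four discs around points \<open>b/r + z'\<close>
  with \<open>|z'| = N\<^sup>-\<^sup>1\<^sup>/\<^sup>2\<close>.
\<close>

section \<open>Gaussian integers\<close>

lemma gauss_0 [simp]: "0 \<in> gauss" and gauss_1 [simp]: "1 \<in> gauss"
  by (auto simp: gauss_def)

lemma gauss_add [intro]: "x \<in> gauss \<Longrightarrow> y \<in> gauss \<Longrightarrow> x + y \<in> gauss"
  and gauss_diff [intro]: "x \<in> gauss \<Longrightarrow> y \<in> gauss \<Longrightarrow> x - y \<in> gauss"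
  and gauss_uminus [intro]: "x \<in> gauss \<Longrightarrow> - x \<in> gauss"
  and gauss_mult [intro]: "x \<in> gauss \<Longrightarrow> y \<in> gauss \<Longrightarrow> x * y \<in> gauss"
  by (auto simp: gauss_def)

lemma gauss_norm_ge_1:
  assumes "x \<in> gauss" "x \<noteq> 0"
  shows "1 \<le> cmod x"
proof -
  have "Re x \<noteq> 0 \<or> Im x \<noteq> 0"
    using assms by (simp add: complex_eq_iff)
  then have "1 \<le> \<bar>Re x\<bar> \<or> 1 \<le> \<bar>Im x\<bar>"
    using assms Ints_nonzero_abs_ge1 by (auto simp: gauss_def)
  then show ?thesis
    using abs_Re_le_cmod[of x] abs_Im_le_cmod[of x] by linarith
qed

lemma finite_gauss_norm_le: "finite {x \<in> gauss. cmod x \<le> B}"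
proof -
  let ?I = "{-\<lceil>B\<rceil>..\<lceil>B\<rceil>}"
  have "x \<in> (\<lambda>(a, b). Complex (of_int a) (of_int b)) ` (?I \<times> ?I)"
    if x: "x \<in> gauss" "cmod x \<le> B" for x
  proof -
    obtain a b where ab: "Re x = of_int a" "Im x = of_int b"
      using x(1) by (auto simp: gauss_def elim!: Ints_cases)
    have "\<bar>real_of_int a\<bar> \<le> B" "\<bar>real_of_int b\<bar> \<le> B"
      using abs_Re_le_cmod[of x] abs_Im_le_cmod[of x] x(2) ab by auto
    then have "a \<in> ?I" "b \<in> ?I"
      by (simp_all; linarith)+
    then show ?thesis
      using ab by (intro image_eqI[of _ _ "(a, b)"]) (auto simp: complex_eq_iff)
  qed
  then have "{x \<in> gauss. cmod x \<le> B} \<subseteq> (\<lambda>(a, b). Complex (of_int a) (of_int b)) ` (?I \<times> ?I)"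
    by blast
  then show ?thesis
    by (rule finite_subset) simp
qed

text \<open>Norms are real numbers, so minimality rests on the finiteness of bounded sets of lattice
  points. It supplies the generator in Bezout's identity and the least denominator in Dirichlet's
  theorem.\<close>

lemma gauss_min_norm:
  assumes "A \<subseteq> gauss" "A \<noteq> {}"
  obtains x where "x \<in> A" "\<And>y. y \<in> A \<Longrightarrow> cmod x \<le> cmod y"
proof -
  obtain w where w: "w \<in> A" using assms by auto
  let ?B = "{x \<in> A. cmod x \<le> cmod w}"
  have "finite ?B"
    using assms(1) by (intro finite_subset[OF _ finite_gauss_norm_le[of "cmod w"]]) auto
  then obtain x where x: "x \<in> ?B" "\<And>y. y \<in> ?B \<Longrightarrow> \<not> cmod y < cmod x"
    using w arg_min_if_finite[of ?B cmod] by blast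
  show ?thesis
  proof (rule that)
    show "x \<in> A" using x(1) by simp
    show "cmod x \<le> cmod y" if "y \<in> A" for y
      using x(2)[of y] x(1) that by force
  qed
qed

definition ground :: "complex \<Rightarrow> complex" where
  "ground w = Complex (of_int (round (Re w))) (of_int (round (Im w)))"

lemma ground_gauss [simp]: "ground w \<in> gauss"
  by (simp add: ground_def gauss_def)

text \<open>Each coordinate is off by at most 1/2. That the distance stays below 1 is what makes
  division with remainder possible.\<close>

lemma norm_diff_ground: "(cmod (w - ground w))\<^sup>2 \<le> 1 / 2"
proof -
  have "\<bar>Re w - of_int (round (Re w))\<bar> \<le> 1/2" "\<bar>Im w - of_int (round (Im w))\<bar> \<le> 1/2"
    using of_int_round_abs_le[of "Re w"] of_int_round_abs_le[of "Im w"] by linarith+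
  then have "(Re w - of_int (round (Re w)))\<^sup>2 \<le> (1/2)\<^sup>2" "(Im w - of_int (round (Im w)))\<^sup>2 \<le> (1/2)\<^sup>2"
    by (metis abs_le_square_iff abs_of_nonneg half_gt_zero_iff less_eq_real_def zero_less_one)+
  then show ?thesis
    by (simp add: cmod_power2 ground_def) (simp add: power2_eq_square)
qed

lemma norm_diff_ground_less: "cmod (w - ground w) < 1"
  using norm_diff_ground[of w] by (intro power2_less_imp_less[of _ 1]) simp_all

lemma norm_mod_ground_less:
  assumes "y \<noteq> 0"
  shows "cmod (x - ground (x / y) * y) < cmod y"
proof -
  have "x - ground (x / y) * y = (x / y - ground (x / y)) * y"
    using assms by (simp add: field_simps)
  then show ?thesis
    using assms norm_diff_ground_less[of "x / y"] by (simp add: norm_mult)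
qed

section \<open>Divisibility, units and coprimality\<close>

lemma gdvdI: "d \<in> gauss \<Longrightarrow> k \<in> gauss \<Longrightarrow> x = d * k \<Longrightarrow> gdvd d x"
  by (auto simp: gdvd_def)

lemma gdvd_gauss: "gdvd d x \<Longrightarrow> d \<in> gauss" "gdvd d x \<Longrightarrow> x \<in> gauss"
  by (auto simp: gdvd_def)

lemma gdvd_trans: "gdvd x y \<Longrightarrow> gdvd y w \<Longrightarrow> gdvd x w"
  by (auto simp: gdvd_def intro!: gauss_mult simp: mult.assoc)

lemma gdvd_mult_left: "gdvd d x \<Longrightarrow> y \<in> gauss \<Longrightarrow> gdvd d (y * x)"
  unfolding gdvd_def by (auto intro: gauss_mult simp: mult.left_commute)

lemma gdvd_add: "gdvd d x \<Longrightarrow> gdvd d y \<Longrightarrow> gdvd d (x + y)"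
  unfolding gdvd_def by (metis gauss_add distrib_left)

lemma gdvd_diff: "gdvd d x \<Longrightarrow> gdvd d y \<Longrightarrow> gdvd d (x - y)"
  unfolding gdvd_def by (metis gauss_diff right_diff_distrib)

lemma gdvd_refl: "x \<in> gauss \<Longrightarrow> gdvd x x"
  by (rule gdvdI[of _ 1]) auto

lemma gunit_norm:
  assumes "gunit u"
  shows "cmod u = 1"
proof -
  obtain k where k: "k \<in> gauss" "1 = u * k" and u: "u \<in> gauss"
    using assms by (auto simp: gunit_def gdvd_def)
  then have "u \<noteq> 0" "k \<noteq> 0" by auto
  then have "1 \<le> cmod u" "1 \<le> cmod k"
    using u k gauss_norm_ge_1 by auto
  moreover have "cmod u * cmod k = 1"
    using k by (metis norm_mult norm_one)
  ultimately show ?thesis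
    using mult_left_mono[of 1 "cmod k" "cmod u"] by simp
qed

lemma gunit_iff_norm:
  assumes "u \<in> gauss"
  shows "gunit u \<longleftrightarrow> cmod u = 1"
proof
  assume "cmod u = 1"
  then have "1 = u * cnj u"
    by (simp add: complex_norm_square[symmetric])
  moreover have "cnj u \<in> gauss"
    using assms by (auto simp: gauss_def)
  ultimately show "gunit u"
    using assms by (auto simp: gunit_def intro: gdvdI)
qed (rule gunit_norm)

lemma gunits: "{u. gunit u} \<subseteq> {1, -1, \<i>, -\<i>}"
proof
  fix u assume "u \<in> {u. gunit u}"
  then have "gunit u" by simp
  then have "u \<in> gauss" and n: "cmod u = 1"
    using gunit_norm by (auto simp: gunit_def gdvd_def)
  then obtain a b where ab: "Re u = of_int a" "Im u = of_int b"
    by (auto simp: gauss_def elim!: Ints_cases)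
  have "real_of_int (a\<^sup>2 + b\<^sup>2) = 1"
    using n ab cmod_power2[of u] by simp
  then have eq: "a\<^sup>2 + b\<^sup>2 = 1"
    by linarith
  then have "\<bar>a\<bar> \<le> 1" "\<bar>b\<bar> \<le> 1"
    by (metis abs_square_le_1 zero_le_power2 le_add_same_cancel1 le_add_same_cancel2)+
  then have "a \<in> {-1, 0, 1}" "b \<in> {-1, 0, 1}" by auto
  then show "u \<in> {1, -1, \<i>, -\<i>}"
    using eq ab by (auto simp: complex_eq_iff)
qed

lemma card_gunits: "finite {u. gunit u}" "card {u. gunit u} \<le> 4"
proof -
  show "finite {u. gunit u}"
    using gunits by (rule finite_subset) simp
  have "card {u. gunit u} \<le> card {1, -1, \<i>, -\<i>}"
    by (rule card_mono[OF _ gunits]) simp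
  also have "\<dots> \<le> 4"
    using card_insert_le_m1 by (simp add: card_insert_if)
  finally show "card {u. gunit u} \<le> 4" .
qed

text \<open>A nonzero element of least norm in the ideal generated by \<open>x\<close> and
  \<open>y\<close> divides every element of the ideal, since remainders stay in the ideal and are
  smaller. It is thus a common divisor, hence a unit.\<close>

lemma gauss_bezout:
  assumes "x \<in> gauss" "y \<in> gauss" "gcoprime x y"
  obtains u v where "u \<in> gauss" "v \<in> gauss" "u * x + v * y = 1"
proof (cases "x = 0 \<and> y = 0")
  case True
  then have "gunit 0"
    using assms unfolding gcoprime_def by (blast intro: gdvd_refl)
  then show ?thesis
    using gunit_norm by force
next
  case False
  define J where "J = {u * x + v * y |u v. u \<in> gauss \<and> v \<in> gauss}"
  have J_gauss: "J \<subseteq> gauss"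
    using assms by (auto simp: J_def)
  have J_I: "p \<in> J" if "p = u * x + v * y" "u \<in> gauss" "v \<in> gauss" for p u v
    using that by (auto simp: J_def)
  have xy: "x \<in> J" "y \<in> J"
    by (rule J_I[of _ 1 0] J_I[of _ 0 1]; simp)+
  have J_diff: "p - k * w \<in> J" if pwk: "p \<in> J" "w \<in> J" "k \<in> gauss" for p w k
  proof -
    obtain u v u' v' where "p = u * x + v * y" "w = u' * x + v' * y"
      and uv: "u \<in> gauss" "v \<in> gauss" "u' \<in> gauss" "v' \<in> gauss"
      using pwk(1,2) unfolding J_def by blast
    then have "p - k * w = (u - k * u') * x + (v - k * v') * y"
      by (simp add: algebra_simps)
    then show ?thesis
      by (rule J_I) (use uv pwk(3) in auto)
  qed
  have "J - {0} \<subseteq> gauss" "J - {0} \<noteq> {}"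
    using J_gauss xy False by auto
  then obtain d where d: "d \<in> J - {0}" and d_min: "\<And>w. w \<in> J - {0} \<Longrightarrow> cmod d \<le> cmod w"
    using gauss_min_norm by metis
  have dvd: "gdvd d p" if "p \<in> J" for p
  proof -
    have "p - ground (p / d) * d \<in> J"
      using J_diff[of p d] that d by auto
    moreover have "cmod (p - ground (p / d) * d) < cmod d"
      using d norm_mod_ground_less by auto
    ultimately have "p - ground (p / d) * d = 0"
      using d_min[of "p - ground (p / d) * d"] by force
    then show ?thesis
      using d J_gauss by (intro gdvdI[of _ "ground (p / d)"]) (auto simp: mult.commute)
  qed
  then have "gunit d"
    using assms(3) xy by (auto simp: gcoprime_def)
  then obtain k where k: "k \<in> gauss" "1 = d * k"
    by (auto simp: gunit_def gdvd_def)
  obtain u v where uv: "u \<in> gauss" "v \<in> gauss" "d = u * x + v * y"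
    using d unfolding J_def by blast
  show ?thesis
    using that[of "k * u" "k * v"] uv k by (auto simp: algebra_simps)
qed

text \<open>Euclid's lemma, by multiplying Bezout's identity by \<open>y\<close>.\<close>

lemma gdvd_coprime_cancel:
  assumes "gdvd d (x * y)" "gcoprime d x" "x \<in> gauss" "y \<in> gauss"
  shows "gdvd d y"
proof -
  have d: "d \<in> gauss" using assms(1) by (rule gdvd_gauss)
  obtain u v where uv: "u \<in> gauss" "v \<in> gauss" "u * d + v * x = 1"
    using gauss_bezout[OF d assms(3,2)] by metis
  have "y = (u * y) * d + v * (x * y)"
    using arg_cong[OF uv(3), of "\<lambda>w. w * y"] by (simp add: algebra_simps)
  moreover have "gdvd d ((u * y) * d + v * (x * y))"
    using uv assms d by (intro gdvd_add gdvd_mult_left[of d d] gdvd_mult_left[of d "x * y"] gdvd_refl) auto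
  ultimately show ?thesis by metis
qed

lemma gcoprime_sym: "gcoprime x y \<Longrightarrow> gcoprime y x"
  by (auto simp: gcoprime_def)

lemma gcoprime_dvd: "gcoprime x y \<Longrightarrow> gdvd d x \<Longrightarrow> gdvd d' y \<Longrightarrow> gcoprime d d'"
  unfolding gcoprime_def using gdvd_trans by blast

lemma gcoprime_shift:
  assumes "gcoprime x q" "x \<in> gauss" "q \<in> gauss" "g \<in> gauss"
  shows "gcoprime (x - g * q) q"
  unfolding gcoprime_def
proof (intro allI impI)
  fix d assume d: "gdvd d (x - g * q) \<and> gdvd d q"
  then have "gdvd d ((x - g * q) + g * q)"
    using assms by (intro gdvd_add gdvd_mult_left) auto
  then show "gunit d" using assms(1) d by (auto simp: gcoprime_def)
qed

lemma gdvd_norm_le: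
  assumes "gdvd t r" "r \<noteq> 0"
  shows "1 \<le> cmod t" "cmod t \<le> cmod r"
proof -
  obtain k where k: "t \<in> gauss" "k \<in> gauss" "r = t * k"
    using assms by (auto simp: gdvd_def)
  then have "1 \<le> cmod t" "1 \<le> cmod k"
    using assms(2) gauss_norm_ge_1 by auto
  then show "1 \<le> cmod t" "cmod t \<le> cmod r"
    using k by (auto simp: norm_mult mult_le_cancel_left1)
qed

text \<open>Remainders modulo \<open>q\<close> are injective on a residue system and fill only a
  bounded part of the lattice. Sums over an infinite system would be 0 by convention, so finiteness
  has to be derived from the axioms of the system.\<close>

lemma finite_reduced_residue_system:
  assumes "reduced_residue_system q R" "q \<in> gauss" "q \<noteq> 0"
  shows "finite R"
proof (rule inj_on_finite)
  show "inj_on (\<lambda>x. x - ground (x / q) * q) R"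
  proof (rule inj_onI)
    fix x y assume xy: "x \<in> R" "y \<in> R" and "x - ground (x / q) * q = y - ground (y / q) * q"
    then have "x - y = q * (ground (x / q) - ground (y / q))"
      by (simp add: algebra_simps)
    then have "gcong x y q"
      unfolding gcong_def by (intro gdvdI[of _ "ground (x / q) - ground (y / q)"]) (auto simp: assms)
    then show "x = y"
      using assms(1) xy by (auto simp: reduced_residue_system_def)
  qed
  show "(\<lambda>x. x - ground (x / q) * q) ` R \<subseteq> {x \<in> gauss. cmod x \<le> cmod q}"
    using assms norm_mod_ground_less[OF assms(3)]
    by (auto simp: reduced_residue_system_def less_imp_le intro!: gauss_diff gauss_mult)
qed (rule finite_gauss_norm_le)

section \<open>The Dirichlet kernel\<close>

lemma e_add: "e (x + y) = e x * e y"
  by (simp add: e_def exp_add[symmetric] distrib_left)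

lemma cnj_e: "cnj (e x) = e (- x)"
  by (simp add: e_def exp_cnj)

lemma e_eq_cis: "e x = cis (2 * pi * x)"
  by (simp add: e_def cis_conv_exp mult_ac)

lemma norm_e [simp]: "cmod (e x) = 1"
  by (simp add: e_eq_cis)

lemma e_Ints [simp]: "n \<in> \<int> \<Longrightarrow> e n = 1"
  by (auto simp: e_def exp_eq_1 elim!: Ints_cases)

lemma e_power: "e x ^ n = e (real n * x)"
  by (simp add: e_def exp_of_nat_mult[symmetric] mult_ac)

text \<open>Its squared modulus is \<open>H\<close> times the Fejer kernel.\<close>

definition dirichlet_kernel :: "nat \<Rightarrow> real \<Rightarrow> complex" where
  "dirichlet_kernel H p = (\<Sum>i<H. e (real i * p))"

lemma dirichlet_kernel_le: "cmod (dirichlet_kernel H p) \<le> H"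
  unfolding dirichlet_kernel_def by (rule order_trans[OF norm_sum]) simp

lemma dirichlet_kernel_add_int: "k \<in> \<int> \<Longrightarrow> dirichlet_kernel H (p + k) = dirichlet_kernel H p"
  unfolding dirichlet_kernel_def by (simp add: distrib_left e_add)

lemma cnj_dirichlet_kernel: "cnj (dirichlet_kernel H p) = dirichlet_kernel H (- p)"
  unfolding dirichlet_kernel_def by (simp add: cnj_e)

lemma norm_dirichlet_kernel_uminus: "cmod (dirichlet_kernel H (- p)) = cmod (dirichlet_kernel H p)"
  by (metis cnj_dirichlet_kernel complex_mod_cnj)

text \<open>Jordan's inequality: the sine is concave here and lies above its chord from (0, 0) to
  (1/2, 1).\<close>

lemma sin_pi_ge:
  assumes "0 \<le> x" "x \<le> 1/2"
  shows "2 * x \<le> sin (pi * x)"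
proof -
  have "concave_on {0..1/2} (\<lambda>x. sin (pi * x))"
    unfolding concave_on_def
  proof (rule f''_ge0_imp_convex)
    fix x :: real assume x: "x \<in> {0..1/2}"
    show "((\<lambda>x. - sin (pi * x)) has_real_derivative - (pi * cos (pi * x))) (at x)"
      by (auto intro!: derivative_eq_intros)
    show "((\<lambda>x. - (pi * cos (pi * x))) has_real_derivative pi * (pi * sin (pi * x))) (at x)"
      by (auto intro!: derivative_eq_intros)
    have "0 \<le> sin (pi * x)"
      using x by (intro sin_ge_zero) (auto simp: field_simps)
    then show "0 \<le> pi * (pi * sin (pi * x))"
      by simp
  qed simp
  from concave_onD[OF this, of "2 * x" 0 "1/2"] show ?thesis
    using assms by simp
qed

lemma norm_e_minus_1: "cmod (e p - 1) = 2 * \<bar>sin (pi * p)\<bar>"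
proof -
  have "(cmod (e p - 1))\<^sup>2 = (cos (2 * (pi * p)) - 1)\<^sup>2 + (sin (2 * (pi * p)))\<^sup>2"
    by (simp add: e_eq_cis cmod_power2 mult.assoc)
  also have "\<dots> = (2 * \<bar>sin (pi * p)\<bar>)\<^sup>2"
    using sin_cos_squared_add[of "pi * p"] unfolding cos_double sin_double by (simp, algebra)
  finally show ?thesis
    by (rule power2_eq_imp_eq) auto
qed

text \<open>\<open>d\<close> is any lower bound for the distance from \<open>p\<close> to the
  nearest integer. The geometric sum is used multiplied out by \<open>e p - 1\<close>, so integer
  \<open>p\<close> needs no separate case.\<close>

lemma dirichlet_kernel_mult_dist:
  assumes "0 \<le> p" "p \<le> 1" and d: "0 \<le> d" "d \<le> p" "d \<le> 1 - p"
  shows "2 * d * cmod (dirichlet_kernel H p) \<le> 1"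
proof -
  have sin: "2 * d \<le> sin (pi * p)"
  proof (cases "p \<le> 1/2")
    case True
    then show ?thesis using sin_pi_ge[of p] assms by simp
  next
    case False
    have "sin (pi * (1 - p)) = sin (pi * p)"
      by (simp add: right_diff_distrib)
    then show ?thesis using False sin_pi_ge[of "1 - p"] assms by simp
  qed
  have "dirichlet_kernel H p * (e p - 1) = e (real H * p) - 1"
    unfolding dirichlet_kernel_def
    using power_diff_1_eq[of "e p" H] by (simp add: e_power mult.commute)
  then have "cmod (dirichlet_kernel H p) * (2 * \<bar>sin (pi * p)\<bar>) = cmod (e (real H * p) - 1)"
    by (metis norm_e_minus_1 norm_mult)
  also have "\<dots> \<le> 2"
    using norm_triangle_ineq4[of "e (real H * p)" 1] by simp
  finally have "cmod (dirichlet_kernel H p) * \<bar>sin (pi * p)\<bar> \<le> 1"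
    by simp
  moreover have "cmod (dirichlet_kernel H p) * (2 * d) \<le> cmod (dirichlet_kernel H p) * \<bar>sin (pi * p)\<bar>"
    using sin by (intro mult_left_mono) auto
  ultimately show ?thesis
    by (simp add: mult_ac)
qed

text \<open>The decay of the squared kernel, divided by \<open>H^2\<close>, at a distance of
  \<open>i\<close> cells of length \<open>1 / H\<close> from an integer; the trivial bound covers
  \<open>i = 0\<close>.\<close>

definition cell_weight :: "nat \<Rightarrow> real" where
  "cell_weight i = (if i = 0 then 1 else 1 / (real i)\<^sup>2)"

lemma cell_weight_nonneg: "0 \<le> cell_weight i"
  by (simp add: cell_weight_def)

lemma sum_cell_weight: "(\<Sum>i<n. cell_weight i) \<le> 3"
proof -
  \<comment> \<open>Subtracting \<open>1 / n\<close> makes the induction telescope. The value 2 at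
    \<open>n = 0\<close> is exact there and leaves room for the term 1 at
    \<open>i = 1\<close>.\<close>
  have "(\<Sum>i<Suc n. cell_weight i) \<le> 3 - (if n = 0 then 2 else 1 / real n)"
  proof (induction n)
    case (Suc n)
    have "1 / (1 + real n)\<^sup>2 \<le> 1 / real n - 1 / (1 + real n)" if "n \<noteq> 0"
    proof -
      have "1 / real n - 1 / (1 + real n) = 1 / (real n * (1 + real n))"
        using that by (simp add: field_simps)
      moreover have "1 / (1 + real n)\<^sup>2 \<le> 1 / (real n * (1 + real n))"
        using that by (intro divide_left_mono) (auto simp: power2_eq_square intro!: mult_pos_pos)
      ultimately show ?thesis by simp
    qed
    then show ?case
      using Suc by (auto simp: cell_weight_def)
  qed (simp add: cell_weight_def)
  then have "(\<Sum>i<Suc n. cell_weight i) \<le> 3"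
    by (rule order_trans) simp
  then show ?thesis
    using cell_weight_nonneg[of n] by simp
qed

text \<open>On cell \<open>i\<close> the distance to the nearest integer is at least
  \<open>j / H\<close>, where \<open>j\<close> counts the whole cells up to the nearer end. Adding
  the weights from both ends, instead of taking the weight of the minimum, lets a reflection handle
  the later sum over all cells.\<close>

lemma dirichlet_kernel_cell:
  assumes "0 < H" "i < H" "real i / H \<le> p" "p < real (i + 1) / H"
  shows "(cmod (dirichlet_kernel H p))\<^sup>2 \<le> (real H)\<^sup>2 * (cell_weight i + cell_weight (H - 1 - i))"
proof -
  let ?D = "cmod (dirichlet_kernel H p)"
  have D: "?D\<^sup>2 \<le> (real H)\<^sup>2"
    using dirichlet_kernel_le by (rule power_mono) simp
  define j where "j = min i (H - 1 - i)"
  have "cell_weight j \<le> cell_weight i + cell_weight (H - 1 - i)"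
    using cell_weight_nonneg by (auto simp: j_def min_def)
  moreover have "?D\<^sup>2 \<le> (real H)\<^sup>2 * cell_weight j"
  proof (cases "j = 0")
    case True
    then show ?thesis using D by (simp add: cell_weight_def)
  next
    case False
    have "real (i + 1) / H \<le> 1" using assms by simp
    then have p: "0 \<le> p" "p \<le> 1"
      using assms(3,4) by (smt (verit) divide_nonneg_nonneg of_nat_0_le_iff)+
    have "real j / H \<le> real i / H"
      by (intro divide_right_mono) (auto simp: j_def)
    then have j1: "real j / H \<le> p" using assms(3) by linarith
    have "real j + real (i + 1) \<le> H"
      using assms(2) by (simp add: j_def)
    then have "real j / H + real (i + 1) / H \<le> 1"
      using assms(1) by (simp add: add_divide_distrib[symmetric])
    then have j2: "real j / H \<le> 1 - p" using assms(4) by linarith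
    have "2 * (real j / H) * ?D \<le> 1"
      using p j1 j2 by (intro dirichlet_kernel_mult_dist) auto
    then have "real j * ?D \<le> real H"
      using assms(1) by (simp add: field_simps)
    then have "(real j * ?D)\<^sup>2 \<le> (real H)\<^sup>2"
      by (rule power_mono) simp
    then show ?thesis
      using False by (simp add: cell_weight_def field_simps)
  qed
  ultimately show ?thesis
    by (smt (verit) mult_left_mono zero_le_power2)
qed

section \<open>The large sieve inequality\<close>

text \<open>For \<open>n = u + v * \<i>\<close> the phase is \<open>Re (n * x k)\<close>; separate
  coordinates allow \<open>u\<close> and \<open>v\<close> to be differences of grid indices.\<close>

definition trig_sum :: "'i set \<Rightarrow> ('i \<Rightarrow> complex) \<Rightarrow> ('i \<Rightarrow> complex) \<Rightarrow> real \<Rightarrow> real \<Rightarrow> complex" where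
  "trig_sum I x c u v = (\<Sum>k\<in>I. c k * e (u * Re (x k) - v * Im (x k)))"

definition kernel_weight :: "nat \<Rightarrow> complex \<Rightarrow> real" where
  "kernel_weight H w = (cmod (dirichlet_kernel H (Re w)))\<^sup>2 * (cmod (dirichlet_kernel H (Im w)))\<^sup>2"

lemma kernel_weight_nonneg: "0 \<le> kernel_weight H w"
  by (simp add: kernel_weight_def)

lemma kernel_weight_commute: "kernel_weight H (w - z) = kernel_weight H (z - w)"
  using norm_dirichlet_kernel_uminus[of H "Re (w - z)"] norm_dirichlet_kernel_uminus[of H "Im (w - z)"]
  by (simp add: kernel_weight_def)

text \<open>The phase is additive in the four indices, so the sum splits into two pairs of conjugate
  geometric sums. This is the source of positivity.\<close>

lemma sum_e_grid:
  "(\<Sum>i<H. \<Sum>j<H. \<Sum>i'<H. \<Sum>j'<H. e ((real i - real j) * p - (real i' - real j') * q))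
     = of_real ((cmod (dirichlet_kernel H p))\<^sup>2 * (cmod (dirichlet_kernel H q))\<^sup>2)"
proof -
  have "e ((real i - real j) * p - (real i' - real j') * q)
      = (e (real i * p) * e (real j * (- p))) * (e (real i' * (- q)) * e (real j' * q))" for i j i' j'
    unfolding e_add[symmetric] by (rule arg_cong[of _ _ e]) (simp add: algebra_simps)
  then have "(\<Sum>i<H. \<Sum>j<H. \<Sum>i'<H. \<Sum>j'<H. e ((real i - real j) * p - (real i' - real j') * q))
    = (dirichlet_kernel H p * dirichlet_kernel H (- p)) * (dirichlet_kernel H (- q) * dirichlet_kernel H q)"
    by (simp add: dirichlet_kernel_def sum_distrib_left[symmetric] sum_distrib_right[symmetric] mult.assoc)
  also have "\<dots> = of_real ((cmod (dirichlet_kernel H p))\<^sup>2) * of_real ((cmod (dirichlet_kernel H q))\<^sup>2)"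
    by (simp only: cnj_dirichlet_kernel[symmetric] complex_norm_square mult.commute)
  finally show ?thesis by simp
qed

text \<open>After the squares are opened, summation over the grid attaches the factor
  \<open>kernel_weight\<close> to \<open>c k * cnj (c l)\<close>. As that factor is nonnegative, the
  triangle inequality loses only the phases of the coefficients.\<close>

lemma sum_trig_sum_grid_le:
  assumes "finite I"
  shows "(\<Sum>i<H. \<Sum>j<H. \<Sum>i'<H. \<Sum>j'<H. (cmod (trig_sum I x c (real i - real j) (real i' - real j')))\<^sup>2)
    \<le> (\<Sum>k\<in>I. \<Sum>l\<in>I. cmod (c k) * cmod (c l) * kernel_weight H (x k - x l))"
    (is "?L \<le> ?R")
proof -
  have sq: "of_real ((cmod (trig_sum I x c u v))\<^sup>2)
    = (\<Sum>k\<in>I. \<Sum>l\<in>I. c k * cnj (c l) * e (u * Re (x k - x l) - v * Im (x k - x l)))" for u v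
  proof -
    have "e (u * Re (x k - x l) - v * Im (x k - x l))
        = e (u * Re (x k) - v * Im (x k)) * cnj (e (u * Re (x l) - v * Im (x l)))" for k l
      unfolding cnj_e e_add[symmetric] by (rule arg_cong[of _ _ e]) (simp add: algebra_simps)
    then show ?thesis
      unfolding complex_norm_square trig_sum_def by (simp add: sum_product mult_ac)
  qed
  have "of_real ?L = (\<Sum>i<H. \<Sum>j<H. \<Sum>i'<H. \<Sum>j'<H. \<Sum>k\<in>I. \<Sum>l\<in>I. c k * cnj (c l) *
      e ((real i - real j) * Re (x k - x l) - (real i' - real j') * Im (x k - x l)))"
    unfolding of_real_sum sq ..
  also have "\<dots> = (\<Sum>k\<in>I. \<Sum>l\<in>I. \<Sum>i<H. \<Sum>j<H. \<Sum>i'<H. \<Sum>j'<H. c k * cnj (c l) *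
      e ((real i - real j) * Re (x k - x l) - (real i' - real j') * Im (x k - x l)))"
    by (simp only: sum.swap[of _ I "{..<H}"])
  also have "\<dots> = (\<Sum>k\<in>I. \<Sum>l\<in>I. c k * cnj (c l) * of_real (kernel_weight H (x k - x l)))"
    unfolding sum_distrib_left[symmetric] sum_e_grid kernel_weight_def ..
  finally have "?L = cmod (\<Sum>k\<in>I. \<Sum>l\<in>I. c k * cnj (c l) * of_real (kernel_weight H (x k - x l)))"
    by (metis (no_types, lifting) abs_of_nonneg norm_of_real sum_nonneg zero_le_power2)
  also have "\<dots> \<le> (\<Sum>k\<in>I. \<Sum>l\<in>I. cmod (c k * cnj (c l) * of_real (kernel_weight H (x k - x l))))"
    by (rule order_trans[OF norm_sum sum_mono[OF norm_sum]])
  also have "\<dots> = ?R"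
    by (simp add: norm_mult kernel_weight_nonneg)
  finally show ?thesis .
qed

text \<open>Bound \<open>f k * f l\<close> by half the sum of the squares; by symmetry both halves
  are the same sum over weighted rows.\<close>

lemma schur_test:
  fixes W :: "'i \<Rightarrow> 'i \<Rightarrow> real"
  assumes nonneg: "\<And>k l. 0 \<le> W k l" and sym: "\<And>k l. W k l = W l k"
    and row: "\<And>k. k \<in> I \<Longrightarrow> (\<Sum>l\<in>I. W k l) \<le> M"
  shows "(\<Sum>k\<in>I. \<Sum>l\<in>I. f k * f l * W k l) \<le> M * (\<Sum>k\<in>I. (f k)\<^sup>2)"
proof -
  have "f k * f l * W k l \<le> ((f k)\<^sup>2 * W k l + (f l)\<^sup>2 * W k l) / 2" for k l
  proof -
    have "f k * f l \<le> ((f k)\<^sup>2 + (f l)\<^sup>2) / 2"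
      using sum_squares_bound[of "f k" "f l"] by simp
    then show ?thesis
      using mult_right_mono[OF _ nonneg[of k l]] by (fastforce simp: field_simps)
  qed
  then have "(\<Sum>k\<in>I. \<Sum>l\<in>I. f k * f l * W k l)
    \<le> (\<Sum>k\<in>I. \<Sum>l\<in>I. ((f k)\<^sup>2 * W k l + (f l)\<^sup>2 * W k l) / 2)"
    by (intro sum_mono)
  also have "\<dots> = ((\<Sum>k\<in>I. \<Sum>l\<in>I. (f k)\<^sup>2 * W k l) + (\<Sum>k\<in>I. \<Sum>l\<in>I. (f l)\<^sup>2 * W k l)) / 2"
    by (simp add: sum_divide_distrib[symmetric] sum.distrib)
  also have "(\<Sum>k\<in>I. \<Sum>l\<in>I. (f l)\<^sup>2 * W k l) = (\<Sum>k\<in>I. \<Sum>l\<in>I. (f k)\<^sup>2 * W k l)"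
    by (subst sum.swap) (simp add: sym)
  also have "((\<Sum>k\<in>I. \<Sum>l\<in>I. (f k)\<^sup>2 * W k l) + (\<Sum>k\<in>I. \<Sum>l\<in>I. (f k)\<^sup>2 * W k l)) / 2
    = (\<Sum>k\<in>I. (f k)\<^sup>2 * (\<Sum>l\<in>I. W k l))"
    by (simp add: sum_distrib_left[symmetric])
  also have "\<dots> \<le> (\<Sum>k\<in>I. (f k)\<^sup>2 * M)"
    using row by (intro sum_mono mult_left_mono) auto
  finally show ?thesis
    by (simp add: sum_distrib_left mult.commute)
qed

text \<open>Cut the torus around \<open>y\<close> into \<open>H^2\<close> square cells of side
  \<open>1 / H\<close>. Each holds at most \<open>K\<close> of the points, and the cell weights sum
  to at most 6 in either coordinate, whence 36.\<close>

lemma kernel_weight_row_sum: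
  fixes x :: "'i \<Rightarrow> complex"
  assumes "finite I" "0 < H"
    and count: "\<And>\<alpha>. real (card {l \<in> I. \<exists>g\<in>gauss. cmod (x l - g - \<alpha>) \<le> 3 / (4 * real H)}) \<le> K"
  shows "(\<Sum>l\<in>I. kernel_weight H (y - x l)) \<le> 36 * K * real H ^ 4"
proof -
  define cell where "cell p = nat \<lfloor>real H * frac p\<rfloor>" for p :: real
  define wt where "wt i = cell_weight i + cell_weight (H - 1 - i)" for i
  have wt: "0 \<le> wt i" for i
    by (simp add: wt_def cell_weight_nonneg)
  have sum_wt: "(\<Sum>i<H. wt i) \<le> 6"
    using sum_cell_weight[of H] sum.nat_diff_reindex[of cell_weight H]
    by (simp add: wt_def sum.distrib)
  have cell_less: "cell p < H" for p
    using frac_lt_1[of p] assms(2) by (simp add: cell_def floor_less_iff nat_less_iff)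
  have cell_bounds: "real (cell p) / H \<le> frac p" "frac p < real (cell p + 1) / H" for p
  proof -
    have "real (cell p) = of_int \<lfloor>real H * frac p\<rfloor>"
      by (simp add: cell_def)
    then have "real (cell p) \<le> real H * frac p" "real H * frac p < real (cell p) + 1"
      by linarith+
    then show "real (cell p) / H \<le> frac p" "frac p < real (cell p + 1) / H"
      using assms(2) by (simp_all add: field_simps)
  qed
  have kernel: "(cmod (dirichlet_kernel H p))\<^sup>2 \<le> (real H)\<^sup>2 * wt (cell p)" for p
  proof -
    have "dirichlet_kernel H p = dirichlet_kernel H (frac p)"
      using dirichlet_kernel_add_int[of "of_int \<lfloor>p\<rfloor>" H "frac p"] by (simp add: frac_def)
    then show ?thesis
      using dirichlet_kernel_cell[OF assms(2) cell_less cell_bounds] by (simp add: wt_def)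
  qed
  define c where "c l = (cell (Re (x l - y)), cell (Im (x l - y)))" for l
  have c: "c ` I \<subseteq> {..<H} \<times> {..<H}"
    using cell_less by (auto simp: c_def)
  have K: "real (card {l \<in> I. c l = (i, j)}) \<le> K" for i j
  proof -
    \<comment> \<open>The midpoint of the cell. Half the diagonal is
      \<open>sqrt 2 / (2 * H)\<close>, and 3/4 is a rational number above
      \<open>sqrt 2 / 2\<close>.\<close>
    define \<alpha> where "\<alpha> = y + Complex ((real i + 1/2) / H) ((real j + 1/2) / H)"
    have "\<exists>g\<in>gauss. cmod (x l - g - \<alpha>) \<le> 3 / (4 * real H)" if l: "l \<in> I" "c l = (i, j)" for l
    proof -
      define g where "g = Complex (of_int \<lfloor>Re (x l - y)\<rfloor>) (of_int \<lfloor>Im (x l - y)\<rfloor>)"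
      define w where "w = x l - g - \<alpha>"
      have half: "\<bar>frac p - (real (cell p) + 1/2) / H\<bar> \<le> 1 / (2 * real H)" for p
        using cell_bounds[of p] assms(2) by (simp add: abs_le_iff field_simps)
      have "Re w = frac (Re (x l - y)) - (real i + 1/2) / H" "Im w = frac (Im (x l - y)) - (real j + 1/2) / H"
        by (simp_all add: w_def g_def \<alpha>_def frac_def)
      then have "\<bar>Re w\<bar> \<le> 1 / (2 * real H)" "\<bar>Im w\<bar> \<le> 1 / (2 * real H)"
        using l(2) half[of "Re (x l - y)"] half[of "Im (x l - y)"] by (auto simp: c_def)
      then have "(Re w)\<^sup>2 \<le> (1 / (2 * real H))\<^sup>2" "(Im w)\<^sup>2 \<le> (1 / (2 * real H))\<^sup>2"
        using power_mono[of "\<bar>Re w\<bar>" _ 2] power_mono[of "\<bar>Im w\<bar>" _ 2] by auto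
      then have "(cmod w)\<^sup>2 \<le> 2 * (1 / (2 * real H))\<^sup>2"
        by (simp add: cmod_power2)
      also have "\<dots> \<le> (3 / (4 * real H))\<^sup>2"
        using assms(2) by (simp add: field_simps power2_eq_square)
      finally have "cmod w \<le> 3 / (4 * real H)"
        by (rule power2_le_imp_le) simp
      then show ?thesis
        by (intro bexI[of _ g]) (auto simp: w_def g_def gauss_def)
    qed
    then have "card {l \<in> I. c l = (i, j)} \<le> card {l \<in> I. \<exists>g\<in>gauss. cmod (x l - g - \<alpha>) \<le> 3 / (4 * real H)}"
      using assms(1) by (intro card_mono) auto
    then show ?thesis
      using count[of \<alpha>] by linarith
  qed
  have K0: "0 \<le> K"
    using count[of 0] by (rule order_trans[rotated]) simp
  have "kernel_weight H (y - x l) \<le> (real H)\<^sup>2 * wt (fst (c l)) * ((real H)\<^sup>2 * wt (snd (c l)))" for l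
    unfolding kernel_weight_commute[of H y "x l"] unfolding kernel_weight_def c_def fst_conv snd_conv
    by (intro mult_mono kernel mult_nonneg_nonneg wt) auto
  then have "(\<Sum>l\<in>I. kernel_weight H (y - x l))
    \<le> (\<Sum>l\<in>I. (real H)\<^sup>2 * wt (fst (c l)) * ((real H)\<^sup>2 * wt (snd (c l))))"
    by (intro sum_mono)
  also have "\<dots> = (\<Sum>ij\<in>{..<H} \<times> {..<H}. \<Sum>l\<in>{l \<in> I. c l = ij}.
      (real H)\<^sup>2 * wt (fst (c l)) * ((real H)\<^sup>2 * wt (snd (c l))))"
    using assms(1) c by (intro sum.group[symmetric]) auto
  also have "\<dots> = (\<Sum>ij\<in>{..<H} \<times> {..<H}. real (card {l \<in> I. c l = ij}) *
      (real H ^ 4 * (wt (fst ij) * wt (snd ij))))"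
    by (intro sum.cong) (simp_all add: power2_eq_square power4_eq_xxxx mult_ac)
  also have "\<dots> \<le> (\<Sum>ij\<in>{..<H} \<times> {..<H}. K * (real H ^ 4 * (wt (fst ij) * wt (snd ij))))"
    using K wt by (intro sum_mono mult_right_mono) (auto intro!: mult_nonneg_nonneg)
  also have "\<dots> = K * real H ^ 4 * ((\<Sum>i<H. wt i) * (\<Sum>j<H. wt j))"
    by (simp add: sum_product sum.cartesian_product sum_distrib_left case_prod_unfold mult_ac)
  also have "\<dots> \<le> K * real H ^ 4 * (6 * 6)"
    using K0 sum_wt wt by (intro mult_left_mono mult_mono) (auto intro!: sum_nonneg)
  finally show ?thesis by (simp add: mult_ac)
qed

text \<open>A coordinate of absolute value at most \<open>s\<close> is a difference
  \<open>i - j\<close> with indices below \<open>4 * s\<close> in at least \<open>2 * s\<close>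
  ways: any \<open>j\<close> in \<open>{s..<3 * s}\<close> leaves room for \<open>i\<close> on both
  sides. The other terms are dropped because \<open>F\<close> is nonnegative. Hence the kernel
  length \<open>4 * s\<close> in what follows.\<close>

lemma sum_grid_ge:
  fixes F :: "real \<Rightarrow> real \<Rightarrow> real"
  assumes F: "\<And>u v. 0 \<le> F u v"
    and B: "B \<subseteq> gauss" "finite B" "\<And>n. n \<in> B \<Longrightarrow> \<bar>Re n\<bar> \<le> real s \<and> \<bar>Im n\<bar> \<le> real s"
  shows "(2 * real s)\<^sup>2 * (\<Sum>n\<in>B. F (Re n) (Im n))
    \<le> (\<Sum>i<4 * s. \<Sum>j<4 * s. \<Sum>i'<4 * s. \<Sum>j'<4 * s. F (real i - real j) (real i' - real j'))"
proof -
  let ?H = "{..<4 * s}" and ?J = "{s..<3 * s}"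
  have inner: "(\<Sum>n\<in>B. F (Re n) (Im n)) \<le> (\<Sum>i\<in>?H. \<Sum>i'\<in>?H. F (real i - real j) (real i' - real j'))"
    if j: "j \<in> ?J" "j' \<in> ?J" for j j'
  proof -
    define h where "h n = (nat (\<lfloor>Re n\<rfloor> + int j), nat (\<lfloor>Im n\<rfloor> + int j'))" for n
    have h: "fst (h n) \<in> ?H" "snd (h n) \<in> ?H" "real (fst (h n)) - real j = Re n" "real (snd (h n)) - real j' = Im n"
      if n: "n \<in> B" for n
    proof -
      obtain a b where ab: "Re n = of_int a" "Im n = of_int b"
        using n B(1) by (auto simp: gauss_def elim!: Ints_cases)
      have "\<bar>a\<bar> \<le> int s" "\<bar>b\<bar> \<le> int s"
        using B(3)[OF n] ab by (simp_all; linarith)+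
      then show "fst (h n) \<in> ?H" "snd (h n) \<in> ?H" "real (fst (h n)) - real j = Re n" "real (snd (h n)) - real j' = Im n"
        using j ab by (auto simp: h_def)
    qed
    have "inj_on h B"
    proof (rule inj_onI)
      fix n n' assume "n \<in> B" "n' \<in> B" "h n = h n'"
      then show "n = n'"
        using h(3,4)[of n] h(3,4)[of n'] by (simp add: complex_eq_iff)
    qed
    have "(\<Sum>n\<in>B. F (Re n) (Im n))
      = (\<Sum>n\<in>B. (\<lambda>(i, i'). F (real i - real j) (real i' - real j')) (h n))"
      using h(3,4) by (intro sum.cong) (simp_all add: case_prod_unfold)
    also have "\<dots> = (\<Sum>(i, i')\<in>h ` B. F (real i - real j) (real i' - real j'))"
      using \<open>inj_on h B\<close> by (simp add: sum.reindex)
    also have "\<dots> \<le> (\<Sum>(i, i')\<in>?H \<times> ?H. F (real i - real j) (real i' - real j'))"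
    proof (rule sum_mono2)
      show "h ` B \<subseteq> ?H \<times> ?H"
        using h(1,2) unfolding image_subset_iff mem_Times_iff by blast
    qed (auto simp: F)
    finally show ?thesis
      by (simp add: sum.cartesian_product)
  qed
  have "(2 * real s)\<^sup>2 * (\<Sum>n\<in>B. F (Re n) (Im n)) = (\<Sum>j\<in>?J. \<Sum>j'\<in>?J. \<Sum>n\<in>B. F (Re n) (Im n))"
    by (simp add: power2_eq_square)
  also have "\<dots> \<le> (\<Sum>j\<in>?J. \<Sum>j'\<in>?J. \<Sum>i\<in>?H. \<Sum>i'\<in>?H. F (real i - real j) (real i' - real j'))"
    by (intro sum_mono inner)
  also have "\<dots> \<le> (\<Sum>j\<in>?J. \<Sum>j'\<in>?H. \<Sum>i\<in>?H. \<Sum>i'\<in>?H. F (real i - real j) (real i' - real j'))"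
    by (intro sum_mono sum_mono2) (auto intro!: sum_nonneg F)
  also have "\<dots> \<le> (\<Sum>j\<in>?H. \<Sum>j'\<in>?H. \<Sum>i\<in>?H. \<Sum>i'\<in>?H. F (real i - real j) (real i' - real j'))"
    by (intro sum_mono2) (auto intro!: sum_nonneg F)
  also have "\<dots> = (\<Sum>j\<in>?H. \<Sum>i\<in>?H. \<Sum>j'\<in>?H. \<Sum>i'\<in>?H. F (real i - real j) (real i' - real j'))"
    by (intro sum.cong refl sum.swap)
  also have "\<dots> = (\<Sum>i\<in>?H. \<Sum>j\<in>?H. \<Sum>j'\<in>?H. \<Sum>i'\<in>?H. F (real i - real j) (real i' - real j'))"
    by (rule sum.swap)
  also have "\<dots> = (\<Sum>i\<in>?H. \<Sum>j\<in>?H. \<Sum>i'\<in>?H. \<Sum>j'\<in>?H. F (real i - real j) (real i' - real j'))"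
    by (intro sum.cong refl sum.swap)
  finally show ?thesis .
qed

text \<open>The grid inequality, the expansion in kernels and the Schur test are chained. The
  constant is \<open>36 * 4^4 / 2^2 = 2304\<close>.\<close>

lemma large_sieve_dual:
  fixes x :: "'i \<Rightarrow> complex"
  assumes "finite I" "0 < s"
    and count: "\<And>\<alpha>. real (card {l \<in> I. \<exists>g\<in>gauss. cmod (x l - g - \<alpha>) \<le> 3 / (4 * real (4 * s))}) \<le> K"
    and B: "B \<subseteq> gauss" "finite B" "\<And>n. n \<in> B \<Longrightarrow> \<bar>Re n\<bar> \<le> real s \<and> \<bar>Im n\<bar> \<le> real s"
  shows "(\<Sum>n\<in>B. (cmod (\<Sum>k\<in>I. c k * e (Re (n * x k))))\<^sup>2)
    \<le> 2304 * K * (real s)\<^sup>2 * (\<Sum>k\<in>I. (cmod (c k))\<^sup>2)"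
proof -
  let ?H = "4 * s"
  have "(2 * real s)\<^sup>2 * (\<Sum>n\<in>B. (cmod (trig_sum I x c (Re n) (Im n)))\<^sup>2)
    \<le> (\<Sum>i<?H. \<Sum>j<?H. \<Sum>i'<?H. \<Sum>j'<?H. (cmod (trig_sum I x c (real i - real j) (real i' - real j')))\<^sup>2)"
    by (rule sum_grid_ge[OF _ B]) auto
  also have "\<dots> \<le> (\<Sum>k\<in>I. \<Sum>l\<in>I. cmod (c k) * cmod (c l) * kernel_weight ?H (x k - x l))"
    by (rule sum_trig_sum_grid_le[OF assms(1)])
  also have "\<dots> \<le> 36 * K * real ?H ^ 4 * (\<Sum>k\<in>I. (cmod (c k))\<^sup>2)"
    using assms by (intro schur_test kernel_weight_nonneg kernel_weight_row_sum kernel_weight_commute) auto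
  also have "\<dots> = (2 * real s)\<^sup>2 * (2304 * K * (real s)\<^sup>2 * (\<Sum>k\<in>I. (cmod (c k))\<^sup>2))"
    by (simp add: power2_eq_square power4_eq_xxxx)
  finally show ?thesis
    using assms(2) by (simp add: trig_sum_def)
qed

text \<open>Duality: the dual inequality is applied to the conjugates of the sums that are to be bounded.\<close>

lemma large_sieve:
  fixes x :: "'i \<Rightarrow> complex"
  assumes "finite I" "0 < s"
    and count: "\<And>\<alpha>. real (card {l \<in> I. \<exists>g\<in>gauss. cmod (x l - g - \<alpha>) \<le> 3 / (4 * real (4 * s))}) \<le> K"
    and B: "B \<subseteq> gauss" "finite B" "\<And>n. n \<in> B \<Longrightarrow> \<bar>Re n\<bar> \<le> real s \<and> \<bar>Im n\<bar> \<le> real s"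
  shows "(\<Sum>k\<in>I. (cmod (\<Sum>n\<in>B. a n * e (Re (n * x k))))\<^sup>2)
    \<le> 2304 * K * (real s)\<^sup>2 * (\<Sum>n\<in>B. (cmod (a n))\<^sup>2)"
proof -
  define T where "T k = (\<Sum>n\<in>B. a n * e (Re (n * x k)))" for k
  define X where "X = (\<Sum>k\<in>I. (cmod (T k))\<^sup>2)"
  define D where "D = 2304 * K * (real s)\<^sup>2"
  define Z where "Z = (\<Sum>n\<in>B. (cmod (a n))\<^sup>2)"
  define G where "G n = (\<Sum>k\<in>I. cnj (T k) * e (Re (n * x k)))" for n
  have "0 \<le> K"
    using count[of 0] by (rule order_trans[rotated]) simp
  then have nonneg: "0 \<le> X" "0 \<le> D" "0 \<le> Z"
    by (auto simp: X_def D_def Z_def intro!: sum_nonneg mult_nonneg_nonneg)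
  have dual: "(\<Sum>n\<in>B. (cmod (G n))\<^sup>2) \<le> D * X"
    using large_sieve_dual[OF assms, of "\<lambda>k. cnj (T k)"] by (simp add: G_def D_def X_def)
  have "of_real X = (\<Sum>k\<in>I. T k * cnj (T k))"
    unfolding X_def of_real_sum complex_norm_square ..
  also have "\<dots> = (\<Sum>k\<in>I. \<Sum>n\<in>B. a n * e (Re (n * x k)) * cnj (T k))"
    by (simp only: T_def[of k for k] sum_distrib_right)
  also have "\<dots> = (\<Sum>n\<in>B. a n * G n)"
    unfolding G_def by (subst sum.swap) (simp add: sum_distrib_left mult_ac)
  finally have "X = cmod (\<Sum>n\<in>B. a n * G n)"
    using nonneg(1) by (metis abs_of_nonneg norm_of_real)
  also have "\<dots> \<le> (\<Sum>n\<in>B. cmod (a n) * cmod (G n))"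
    by (rule order_trans[OF norm_sum]) (simp add: norm_mult)
  finally have "X\<^sup>2 \<le> (\<Sum>n\<in>B. cmod (a n) * cmod (G n))\<^sup>2"
    using nonneg(1) by (rule power_mono)
  also have "\<dots> \<le> Z * (\<Sum>n\<in>B. (cmod (G n))\<^sup>2)"
    unfolding Z_def by (rule Cauchy_Schwarz_ineq_sum)
  also have "\<dots> \<le> Z * (D * X)"
    using dual nonneg by (intro mult_left_mono)
  finally have "X * X \<le> (D * Z) * X"
    by (simp add: power2_eq_square mult_ac)
  then have "X \<le> D * Z"
    using nonneg by (cases "X = 0") auto
  then show ?thesis
    by (simp add: X_def D_def Z_def T_def)
qed

section \<open>Dirichlet approximation by Gaussian rationals\<close>

text \<open>
  Pigeonhole on the discrete torus modulo \<open>L\<close>: to each Gaussian integer \<open>r\<close> in the box of side \<open>M\<close> attach the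
  \<open>\<sigma> \<times> \<sigma>\<close> square of grid points at \<open>L r \<alpha>\<close>. These squares cannot be disjoint. Compared with distributing the
  points \<open>r \<alpha>\<close> over boxes, this gains the factor \<open>(M + 1) / M\<close> which is needed for the constant 2.
\<close>

lemma gauss_dirichlet_grid:
  fixes \<alpha> :: complex and M \<sigma> L :: nat
  assumes "0 < \<sigma>" "\<sigma> \<le> L" "L < (M + 1) * \<sigma>"
  obtains r b where "r \<in> gauss" "b \<in> gauss" "r \<noteq> 0" "\<bar>Re r\<bar> \<le> real M" "\<bar>Im r\<bar> \<le> real M"
    "\<bar>Re (r * \<alpha> - b)\<bar> \<le> real \<sigma> / L" "\<bar>Im (r * \<alpha> - b)\<bar> \<le> real \<sigma> / L"
proof -
  define pt where "pt u v = Complex (real u) (real v)" for u v :: nat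
  define F where "F = (\<lambda>((u, v), (w, w')).
    ((\<lfloor>real L * Re (pt u v * \<alpha>)\<rfloor> + int w) mod int L, (\<lfloor>real L * Im (pt u v * \<alpha>)\<rfloor> + int w') mod int L))"
  define A where "A = ({..M} \<times> {..M}) \<times> ({..<\<sigma>} \<times> {..<\<sigma>})"
  have L: "0 < L" using assms by simp
  have "F ` A \<subseteq> {0..<int L} \<times> {0..<int L}"
    using L by (auto simp: F_def)
  then have "card (F ` A) \<le> L * L"
    using card_mono[of "{0..<int L} \<times> {0..<int L}" "F ` A"] by (simp add: card_cartesian_product)
  also have "\<dots> < ((M + 1) * \<sigma>) * ((M + 1) * \<sigma>)"
    using assms(3) by (intro mult_strict_mono) auto
  also have "\<dots> = card A"
    by (simp add: A_def card_cartesian_product algebra_simps)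
  finally have "\<not> inj_on F A"
    using pigeonhole by blast
  then obtain a a' where a: "a \<in> A" "a' \<in> A" "F a = F a'" "a \<noteq> a'"
    unfolding inj_on_def by blast
  obtain u v w x where a1: "a = ((u, v), (w, x))" by (metis surj_pair)
  obtain u' v' w' x' where a2: "a' = ((u', v'), (w', x'))" by (metis surj_pair)
  have le: "u \<le> M" "v \<le> M" "u' \<le> M" "v' \<le> M" "w < \<sigma>" "x < \<sigma>" "w' < \<sigma>" "x' < \<sigma>"
    using a(1,2) by (auto simp: A_def a1 a2)
  define r where "r = pt u v - pt u' v'"
  \<comment> \<open>One coordinate of a collision. Offsets below \<open>\<sigma>\<close> differ by
    at most \<open>\<sigma> - 1\<close>, and the two floors cost less than 1. The second conclusion
    excludes \<open>r = 0\<close>: equal points force equal offsets, as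
    \<open>\<sigma> \<le> L\<close>, and then the colliding indices would coincide.\<close>
  have coll: "\<exists>k. \<bar>s - s' - of_int k\<bar> \<le> real \<sigma> / L \<and> (s = s' \<longrightarrow> p = p')"
    if eq: "(\<lfloor>real L * s\<rfloor> + int p) mod int L = (\<lfloor>real L * s'\<rfloor> + int p') mod int L"
      and pp: "p < \<sigma>" "p' < \<sigma>" for s s' :: real and p p' :: nat
  proof -
    have "int L dvd (\<lfloor>real L * s\<rfloor> + int p) - (\<lfloor>real L * s'\<rfloor> + int p')"
      using eq by (simp add: mod_eq_dvd_iff)
    then obtain k where k: "(\<lfloor>real L * s\<rfloor> + int p) - (\<lfloor>real L * s'\<rfloor> + int p') = int L * k"
      by (auto elim: dvdE)
    have "\<bar>(real L * s - real L * s') - real L * of_int k\<bar> \<le> real \<sigma>"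
    proof -
      have "of_int (\<lfloor>real L * s\<rfloor> - \<lfloor>real L * s'\<rfloor>) = real L * of_int k + real p' - real p"
        using arg_cong[OF k, of real_of_int] by simp
      moreover have "\<bar>real p' - real p\<bar> \<le> real \<sigma> - 1"
        using pp by linarith
      ultimately show ?thesis
        by simp linarith
    qed
    moreover have "(real L * s - real L * s') - real L * of_int k = real L * (s - s' - of_int k)"
      by (simp add: algebra_simps)
    ultimately have "real L * \<bar>s - s' - of_int k\<bar> \<le> real \<sigma>"
      by (simp add: abs_mult)
    then have "\<bar>s - s' - of_int k\<bar> \<le> real \<sigma> / L"
      using L by (simp add: field_simps)
    moreover have "p = p'" if "s = s'"
    proof -
      have "int L dvd int p - int p'"
        using k that by simp
      moreover have "\<bar>int p - int p'\<bar> < int L"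
        using pp assms(2) by linarith
      ultimately show ?thesis
        using dvd_imp_le_int[of "int p - int p'" "int L"] by fastforce
    qed
    ultimately show ?thesis by blast
  qed
  have F: "(\<lfloor>real L * Re (pt u v * \<alpha>)\<rfloor> + int w) mod int L = (\<lfloor>real L * Re (pt u' v' * \<alpha>)\<rfloor> + int w') mod int L"
    "(\<lfloor>real L * Im (pt u v * \<alpha>)\<rfloor> + int x) mod int L = (\<lfloor>real L * Im (pt u' v' * \<alpha>)\<rfloor> + int x') mod int L"
    using a(3) by (simp_all add: F_def a1 a2)
  obtain b1 where b1: "\<bar>Re (pt u v * \<alpha>) - Re (pt u' v' * \<alpha>) - of_int b1\<bar> \<le> real \<sigma> / L"
    and w: "Re (pt u v * \<alpha>) = Re (pt u' v' * \<alpha>) \<longrightarrow> w = w'"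
    using coll[OF F(1) le(5,7)] by blast
  obtain b2 where b2: "\<bar>Im (pt u v * \<alpha>) - Im (pt u' v' * \<alpha>) - of_int b2\<bar> \<le> real \<sigma> / L"
    and x: "Im (pt u v * \<alpha>) = Im (pt u' v' * \<alpha>) \<longrightarrow> x = x'"
    using coll[OF F(2) le(6,8)] by blast
  define b where "b = Complex (of_int b1) (of_int b2)"
  show ?thesis
  proof (rule that[of r b])
    show "r \<in> gauss" "b \<in> gauss"
      by (auto simp: r_def b_def pt_def gauss_def)
    show "r \<noteq> 0"
    proof
      assume "r = 0"
      then have "u = u'" "v = v'"
        by (auto simp: r_def pt_def complex_eq_iff)
      then show False
        using w x a(4) by (simp add: a1 a2)
    qed
    show "\<bar>Re r\<bar> \<le> real M" "\<bar>Im r\<bar> \<le> real M"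
      using le by (auto simp: r_def pt_def)
    show "\<bar>Re (r * \<alpha> - b)\<bar> \<le> real \<sigma> / L"
      using b1 by (simp add: r_def b_def algebra_simps)
    show "\<bar>Im (r * \<alpha> - b)\<bar> \<le> real \<sigma> / L"
      using b2 by (simp add: r_def b_def algebra_simps)
  qed
qed

lemma cmod_le_sqrt2_mult:
  assumes "\<bar>Re z\<bar> \<le> B" "\<bar>Im z\<bar> \<le> B"
  shows "cmod z \<le> sqrt 2 * B"
proof (rule power2_le_imp_le)
  show "0 \<le> sqrt 2 * B" using assms by simp
  have "(Re z)\<^sup>2 \<le> B\<^sup>2" "(Im z)\<^sup>2 \<le> B\<^sup>2"
    using assms power_mono[of "\<bar>Re z\<bar>" B 2] power_mono[of "\<bar>Im z\<bar>" B 2] by auto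
  then show "(cmod z)\<^sup>2 \<le> (sqrt 2 * B)\<^sup>2"
    by (simp add: cmod_power2 power_mult_distrib)
qed

text \<open>The square box inside the disc of radius \<open>T\<close> has half-side
  \<open>T / sqrt 2\<close>, and an error of \<open>sqrt 2 / T\<close> in each coordinate has
  modulus at most \<open>2 / T\<close>; passing between box and disc costs \<open>sqrt 2\<close>
  twice. For \<open>T < sqrt 2\<close> the denominator 1 is good enough.\<close>

lemma gauss_dirichlet:
  assumes "1 \<le> T"
  obtains r b where "r \<in> gauss" "b \<in> gauss" "r \<noteq> 0" "cmod r \<le> T" "cmod (r * \<alpha> - b) \<le> 2 / T"
proof (cases "T < sqrt 2")
  case True
  have "1 \<le> 2 / T"
    using True assms sqrt2_less_2 by (simp add: le_divide_eq)
  moreover have "cmod (1 * \<alpha> - ground \<alpha>) \<le> 1"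
    using norm_diff_ground_less[of \<alpha>] by simp
  ultimately have "cmod (1 * \<alpha> - ground \<alpha>) \<le> 2 / T"
    by linarith
  then show ?thesis
    using assms by (intro that[of 1 "ground \<alpha>"]) auto
next
  case False
  define M where "M = nat \<lfloor>T / sqrt 2\<rfloor>"
  have "1 \<le> T / sqrt 2"
    using False by (simp add: le_divide_eq)
  then have M: "1 \<le> M" "real M \<le> T / sqrt 2" "T / sqrt 2 < real M + 1"
    unfolding M_def by linarith+
  \<comment> \<open>The floor makes \<open>M + 1\<close> strictly larger than
    \<open>T / sqrt 2\<close>; this slack pays for the mesh width \<open>1 / L\<close>.\<close>
  define \<epsilon> where "\<epsilon> = sqrt 2 / T - 1 / (real M + 1)"
  have "T < sqrt 2 * (real M + 1)"
    using M(3) by (simp add: divide_less_eq mult.commute)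
  then have "T / (real M + 1) < sqrt 2"
    by (simp add: divide_less_eq)
  then have "1 / (real M + 1) < sqrt 2 / T"
    using assms by (simp add: less_divide_eq)
  then have "0 < \<epsilon>" by (simp add: \<epsilon>_def)
  then obtain L0 :: nat where L0: "1 / \<epsilon> < real L0"
    using reals_Archimedean2 by blast
  define L where "L = L0 + 2"
  have L: "2 \<le> L" "1 / real L \<le> \<epsilon>"
  proof -
    have "1 / \<epsilon> \<le> real L" using L0 by (simp add: L_def)
    then show "1 / real L \<le> \<epsilon>"
      using \<open>0 < \<epsilon>\<close> by (simp add: L_def divide_le_eq mult.commute)
  qed (simp add: L_def)
  \<comment> \<open>The least integer with \<open>L < (M + 1) * \<sigma>\<close>, so
    \<open>\<sigma> / L\<close> exceeds \<open>1 / (M + 1)\<close> by at most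
    \<open>1 / L\<close>.\<close>
  define \<sigma> where "\<sigma> = L div (M + 1) + 1"
  have "L div (M + 1) < L"
    using M(1) L(1) by (intro div_less_dividend) auto
  then have \<sigma>1: "0 < \<sigma>" "\<sigma> \<le> L"
    by (auto simp: \<sigma>_def)
  have \<sigma>2: "L < (M + 1) * \<sigma>"
    using dividend_less_times_div[of "M + 1" L] by (simp add: \<sigma>_def)
  have "real (L div (M + 1)) \<le> real L / (real M + 1)"
    using of_nat_div_le_of_nat[of L "M + 1"] by (simp add: add.commute)
  then have "real \<sigma> / L \<le> (real L / (real M + 1) + 1) / L"
    by (intro divide_right_mono) (auto simp: \<sigma>_def)
  also have "\<dots> = 1 / (real M + 1) + 1 / L"
    using L(1) by (simp add: field_simps)
  also have "\<dots> \<le> sqrt 2 / T"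
    using L(2) by (simp add: \<epsilon>_def)
  finally have \<sigma>3: "real \<sigma> / L \<le> sqrt 2 / T" .
  obtain r b where rb: "r \<in> gauss" "b \<in> gauss" "r \<noteq> 0" "\<bar>Re r\<bar> \<le> real M" "\<bar>Im r\<bar> \<le> real M"
    "\<bar>Re (r * \<alpha> - b)\<bar> \<le> real \<sigma> / L" "\<bar>Im (r * \<alpha> - b)\<bar> \<le> real \<sigma> / L"
    using gauss_dirichlet_grid[OF \<sigma>1 \<sigma>2] by metis
  show ?thesis
  proof (rule that[OF rb(1-3)])
    have "cmod r \<le> sqrt 2 * (T / sqrt 2)"
      using rb(4,5) M(2) by (intro cmod_le_sqrt2_mult) auto
    then show "cmod r \<le> T" by simp
    have "cmod (r * \<alpha> - b) \<le> sqrt 2 * (sqrt 2 / T)"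
      using rb(6,7) \<sigma>3 by (intro cmod_le_sqrt2_mult) auto
    then show "cmod (r * \<alpha> - b) \<le> 2 / T" by simp
  qed
qed

text \<open>Among all admissible denominators one of least norm has a numerator coprime to it.\<close>

lemma gauss_dirichlet_coprime:
  assumes "1 \<le> T"
  obtains r b where "r \<in> gauss" "b \<in> gauss" "r \<noteq> 0" "gcoprime b r" "cmod r \<le> T"
    "cmod (\<alpha> - b / r) \<le> 2 / (cmod r * T)"
proof -
  define A where "A = {r \<in> gauss. r \<noteq> 0 \<and> cmod r \<le> T \<and> (\<exists>b\<in>gauss. cmod (r * \<alpha> - b) \<le> 2 / T)}"
  have "A \<noteq> {}"
  proof -
    obtain r b where "r \<in> gauss" "b \<in> gauss" "r \<noteq> 0" "cmod r \<le> T" "cmod (r * \<alpha> - b) \<le> 2 / T"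
      by (rule gauss_dirichlet[OF assms])
    then show ?thesis
      unfolding A_def by blast
  qed
  moreover have "A \<subseteq> gauss"
    by (auto simp: A_def)
  ultimately obtain r where r: "r \<in> A" and min: "\<And>s. s \<in> A \<Longrightarrow> cmod r \<le> cmod s"
    using gauss_min_norm by metis
  obtain b where b: "b \<in> gauss" "cmod (r * \<alpha> - b) \<le> 2 / T"
    using r by (auto simp: A_def)
  have r': "r \<in> gauss" "r \<noteq> 0" "cmod r \<le> T"
    using r by (auto simp: A_def)
  have "gcoprime b r"
    unfolding gcoprime_def
  proof (intro allI impI)
    fix d assume d: "gdvd d b \<and> gdvd d r"
    then obtain b' s where bs: "b' \<in> gauss" "b = d * b'" "s \<in> gauss" "r = d * s"
      by (auto simp: gdvd_def)
    have d1: "d \<in> gauss" "1 \<le> cmod d"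
      using d gdvd_norm_le(1)[of d r] r'(2) by (auto simp: gdvd_def)
    have s: "s \<noteq> 0" using bs r' by auto
    \<comment> \<open>Cancelling \<open>d\<close> increases neither the denominator nor the error,
      so \<open>s\<close> is admissible as well and minimality forces
      \<open>|d| \<le> 1\<close>.\<close>
    have "r * \<alpha> - b = d * (s * \<alpha> - b')"
      by (simp add: bs algebra_simps)
    then have "cmod (s * \<alpha> - b') \<le> cmod (r * \<alpha> - b)" "cmod s \<le> cmod r"
      using d1 bs(4) by (auto simp: norm_mult mult_le_cancel_right1)
    then have "s \<in> A"
      using bs s b(2) r'(3) unfolding A_def by (auto intro!: bexI[of _ b'])
    then have "cmod r \<le> cmod s" by (rule min)
    then have "cmod d \<le> 1"
      using s by (simp add: bs(4) norm_mult)
    then show "gunit d"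
      using d1 by (simp add: gunit_iff_norm)
  qed
  moreover have "cmod (\<alpha> - b / r) \<le> 2 / (cmod r * T)"
  proof -
    have "\<alpha> - b / r = (r * \<alpha> - b) / r"
      using r'(2) by (simp add: field_simps)
    then have "cmod (\<alpha> - b / r) \<le> (2 / T) / cmod r"
      using divide_right_mono[OF b(2), of "cmod r"] by (simp add: norm_divide)
    then show ?thesis by (simp add: mult.commute)
  qed
  ultimately show ?thesis
    using that r' b(1) by blast
qed

section \<open>Fractions near a given point\<close>

lemma Sdiv_subset:
  assumes "S \<subseteq> cball 0 \<rho>" "t \<noteq> 0"
  shows "Sdiv S t \<subseteq> cball 0 (\<rho> / cmod t)"
proof
  fix q assume "q \<in> Sdiv S t"
  then have "cmod (t * q) \<le> \<rho>"
    using assms(1) by (auto simp: Sdiv_def)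
  then show "q \<in> cball 0 (\<rho> / cmod t)"
    using assms(2) by (simp add: norm_mult field_simps)
qed

lemma card_Sdiv:
  assumes "finite S" "t \<noteq> 0"
  shows "finite (Sdiv S t)" "card (Sdiv S t) \<le> card S"
proof -
  have "inj_on ((*) t) (Sdiv S t)" "(*) t ` Sdiv S t \<subseteq> S"
    using assms(2) by (auto simp: inj_on_def Sdiv_def)
  then show "finite (Sdiv S t)" "card (Sdiv S t) \<le> card S"
    using assms(1) inj_on_finite card_inj_on_le by blast+
qed

lemma A_cnt_bounds:
  assumes "finite S" "t \<noteq> 0"
  shows "bdd_above ((\<lambda>y. real (card {q \<in> Sdiv S t \<inter> cball y u. gcong q l k})) ` Y)"
    and "A_cnt Q S t u k l \<le> real (card S)"
proof -
  have le: "real (card {q \<in> Sdiv S t \<inter> cball y u. gcong q l k}) \<le> real (card S)" for y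
  proof -
    have "card {q \<in> Sdiv S t \<inter> cball y u. gcong q l k} \<le> card (Sdiv S t)"
      using card_Sdiv(1)[OF assms] by (intro card_mono) auto
    then show ?thesis
      using card_Sdiv(2)[OF assms] by simp
  qed
  then show "bdd_above ((\<lambda>y. real (card {q \<in> Sdiv S t \<inter> cball y u. gcong q l k})) ` Y)"
    by (intro bdd_aboveI2)
  show "A_cnt Q S t u k l \<le> real (card S)"
    unfolding A_cnt_def
  proof (rule cSUP_least)
    have "0 \<in> {y. cmod y \<le> sqrt (real Q) / cmod t}" by simp
    then show "{y. cmod y \<le> sqrt (real Q) / cmod t} \<noteq> {}" by blast
  qed (rule le)
qed

text \<open>The centre may be arbitrary: projecting it to the disc that contains \<open>Sdiv S t\<close> loses no point.\<close>

lemma card_le_A_cnt: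
  assumes "finite S" "t \<noteq> 0" "S \<subseteq> cball 0 (sqrt (real Q))"
  shows "real (card {q \<in> Sdiv S t \<inter> cball y u. gcong q l k}) \<le> A_cnt Q S t u k l"
proof -
  define \<rho> where "\<rho> = sqrt (real Q) / cmod t"
  define p where "p = closest_point (cball (0::complex) \<rho>)"
  have ne: "cball (0::complex) \<rho> \<noteq> {}"
    by (simp add: \<rho>_def not_less)
  have p: "cmod (p y) \<le> \<rho>"
    using closest_point_in_set[OF _ ne, of y] by (simp add: p_def)
  have "q \<in> cball (p y) u" if "q \<in> Sdiv S t" "q \<in> cball y u" for q
  proof -
    have "q \<in> cball 0 \<rho>"
      using Sdiv_subset[OF assms(3,2)] that(1) by (auto simp: \<rho>_def)
    then have "p q = q"
      by (simp add: p_def closest_point_self)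
    then have "dist (p y) q \<le> dist y q"
      using closest_point_lipschitz[OF _ _ ne, of y q] by (simp add: p_def)
    then show ?thesis
      using that(2) by simp
  qed
  then have "card {q \<in> Sdiv S t \<inter> cball y u. gcong q l k} \<le> card {q \<in> Sdiv S t \<inter> cball (p y) u. gcong q l k}"
    using card_Sdiv(1)[OF assms(1,2)] by (intro card_mono) auto
  also have "real (card {q \<in> Sdiv S t \<inter> cball (p y) u. gcong q l k}) \<le> A_cnt Q S t u k l"
    unfolding A_cnt_def
    using p A_cnt_bounds(1)[OF assms(1,2)] by (intro cSUP_upper) (auto simp: \<rho>_def)
  finally show ?thesis by simp
qed

lemma A_cnt_nonneg:
  assumes "finite S" "t \<noteq> 0" "S \<subseteq> cball 0 (sqrt (real Q))"
  shows "0 \<le> A_cnt Q S t u k l"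
  using card_le_A_cnt[OF assms, of 0 u l k] by (rule order_trans[rotated]) simp

lemma divisor_system_subset:
  assumes "divisor_system r D" "r \<noteq> 0"
  shows "D \<subseteq> {t \<in> gauss. cmod t \<le> cmod r}" "0 \<notin> D"
  using assms gdvd_norm_le[of _ r] gdvd_gauss(1) by (force simp: divisor_system_def)+

text \<open>A common divisor of largest norm is replaced by its associate in \<open>D\<close>. A
  nonunit common factor of the cofactors would produce a still larger common divisor.\<close>

lemma divisor_system_gcd:
  assumes "divisor_system r D" "r \<in> gauss" "r \<noteq> 0" "q \<in> gauss"
  obtains t r' q' where "t \<in> D" "t \<noteq> 0" "r' \<in> gauss" "q' \<in> gauss" "r = t * r'" "q = t * q'" "gcoprime r' q'"
proof -
  define C where "C = {t. gdvd t r \<and> gdvd t q}"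
  have "finite C"
    using gdvd_norm_le(2)[OF _ assms(3)] gdvd_gauss(1)
    by (intro finite_subset[OF _ finite_gauss_norm_le[of "cmod r"]]) (auto simp: C_def)
  moreover have "1 \<in> C"
    using assms by (auto simp: C_def intro: gdvdI)
  ultimately obtain t0 where t0: "t0 \<in> C" "\<And>t. t \<in> C \<Longrightarrow> cmod t \<le> cmod t0"
    using Max_in[of "cmod ` C"] Max_ge[of "cmod ` C"] by fastforce
  then obtain t where t: "t \<in> D" "gassoc t0 t"
    using assms(1) by (auto simp: divisor_system_def C_def)
  then obtain u where u: "gunit u" "t = u * t0"
    by (auto simp: gassoc_def)
  have t_dvd: "gdvd t r" and "t \<noteq> 0" and t_gauss: "t \<in> gauss"
    using t(1) assms divisor_system_subset[OF assms(1,3)] by (auto simp: divisor_system_def)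
  obtain r' where r': "r' \<in> gauss" "r = t * r'"
    using t_dvd by (auto simp: gdvd_def)
  obtain v k where "v \<in> gauss" "1 = u * v" "k \<in> gauss" "q = t0 * k"
    using u(1) t0(1) by (auto simp: gunit_def gdvd_def C_def)
  then have q': "v * k \<in> gauss" "q = t * (v * k)"
    using u(2) by (auto simp: mult_ac)
  show ?thesis
  proof (rule that[OF t(1) \<open>t \<noteq> 0\<close> r'(1) q'(1) r'(2) q'(2)])
    show "gcoprime r' (v * k)"
      unfolding gcoprime_def
    proof (intro allI impI)
      fix d assume d: "gdvd d r' \<and> gdvd d (v * k)"
      then obtain x y where xy: "d \<in> gauss" "x \<in> gauss" "r' = d * x" "y \<in> gauss" "v * k = d * y"
        by (auto simp: gdvd_def)
      have "t * d \<in> C"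
        unfolding C_def using gdvdI[of "t * d" x r] gdvdI[of "t * d" y q] xy r' q' t_gauss
        by (simp add: gauss_mult mult.assoc)
      then have "cmod t * cmod d \<le> cmod t0"
        using t0(2) by (metis norm_mult)
      moreover have "cmod t = cmod t0"
        using u gunit_norm by (simp add: norm_mult)
      ultimately have "cmod d \<le> 1"
        using \<open>t \<noteq> 0\<close> by (metis mult.right_neutral mult_le_cancel_left_pos zero_less_norm_iff)
      moreover have "1 \<le> cmod d"
        using d gdvd_norm_le(1)[of d r'] r' assms(3) by auto
      ultimately show "gunit d"
        using xy(1) by (simp add: gunit_iff_norm)
    qed
  qed
qed

section \<open>Counting fractions in a disc around \<open>b / r + z\<close>\<close>

definition local_count :: "nat \<Rightarrow> nat \<Rightarrow> complex set \<Rightarrow> complex set \<Rightarrow> complex \<Rightarrow> complex \<Rightarrow> complex \<Rightarrow> real" where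
  "local_count Q N S D r z h =
    (\<Sum>t\<in>D. \<Sum>m\<in>{m\<in>gauss. 0 < cmod m \<and>
        cmod m \<le> 3 * cmod (r * z) * sqrt (real Q) / cmod t \<and> gcoprime m (r / t)}.
      A_cnt Q S t (sqrt (real Q) / (sqrt (real N) * cmod (z * t))) (r / t) (h * m))"

text \<open>The numerator is not reduced modulo \<open>q\<close>, so the disc lies in the plane and
  not on the torus. Pairs are kept instead of quotients because associates in \<open>S\<close> yield
  the same quotients and must be counted separately.\<close>

definition fractions_near :: "complex set \<Rightarrow> complex \<Rightarrow> real \<Rightarrow> (complex \<times> complex) set" where
  "fractions_near S \<alpha> \<rho> = {(q, a). q \<in> S \<and> a \<in> gauss \<and> gcoprime a q \<and> cmod (a / q - \<alpha>) \<le> \<rho>}"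

text \<open>Both fractions are reduced, so by Euclid's lemma \<open>q\<close> and \<open>r\<close>
  divide each other and differ by a unit.\<close>

lemma fractions_equal_subset:
  assumes "r \<in> gauss" "r \<noteq> 0" "b \<in> gauss" "gcoprime b r"
    and qa: "q \<in> gauss" "q \<noteq> 0" "a \<in> gauss" "gcoprime a q" "a * r = b * q"
  shows "(q, a) \<in> (\<lambda>u. (u * r, u * b)) ` {u. gunit u}"
proof -
  have "gdvd q (a * r)"
    unfolding qa(5) using qa assms by (intro gdvd_mult_left gdvd_refl)
  then have "gdvd q r"
    using qa assms gcoprime_sym by (intro gdvd_coprime_cancel[of q a r]) auto
  have "gdvd r (b * q)"
    unfolding qa(5)[symmetric] using qa assms by (intro gdvd_mult_left gdvd_refl)
  then have "gdvd r q"
    using qa assms gcoprime_sym by (intro gdvd_coprime_cancel[of r b q]) auto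
  then obtain u where u: "u \<in> gauss" "q = r * u"
    by (auto simp: gdvd_def)
  obtain v where v: "v \<in> gauss" "r = q * v"
    using \<open>gdvd q r\<close> by (auto simp: gdvd_def)
  have "r * 1 = r * (u * v)"
    using u(2) v(2) by (metis mult.assoc mult.right_neutral)
  then have "1 = u * v"
    using assms(2) by simp
  then have "gunit u"
    using u v by (auto simp: gunit_def intro: gdvdI)
  moreover have "a = u * b"
    using qa(5) u(2) assms(2) by simp
  ultimately show ?thesis
    using u(2) by (auto simp: mult.commute)
qed

text \<open>Put \<open>w = a / q - b / r - z\<close>; then \<open>m = r * q' * (z + w)\<close> with
  \<open>|w| \<le> N^(-1/2) \<le> |z|\<close>. This bounds \<open>|m|\<close>, and solving for
  \<open>q'\<close> places it within \<open>|q' * w / z|\<close> of \<open>m / (r * z)\<close>. For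
  the residue class, reduce \<open>m = a * r' - b * q'\<close> modulo \<open>r' = r / t\<close> and
  multiply by the inverse \<open>u\<close> of \<open>b\<close>.\<close>

lemma fraction_parametrisation:
  assumes S: "S \<subseteq> cball 0 (sqrt (real Q)) \<inter> (gauss - {0})" and N: "0 < N"
    and r: "r \<in> gauss" "r \<noteq> 0" and b: "b \<in> gauss" "gcoprime b r"
    and uv: "u \<in> gauss" "v \<in> gauss" "u * b + v * r = 1"
    and D: "divisor_system r D"
    and z: "1 / sqrt (real N) \<le> cmod z"
    and qa: "(q, a) \<in> fractions_near S (b / r + z) (1 / sqrt (real N))" "a * r \<noteq> b * q"
  obtains t m q' where "t \<in> D" "q = t * q'" "a = (t * m + b * q) / r"
    "m \<in> gauss" "0 < cmod m" "cmod m \<le> 3 * cmod (r * z) * sqrt (real Q) / cmod t" "gcoprime m (r / t)"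
    "q' \<in> Sdiv S t" "q' \<in> cball (m / (r * z)) (sqrt (real Q) / (sqrt (real N) * cmod (z * t)))"
    "gcong q' (- u * m) (r / t)"
proof -
  define \<delta> where "\<delta> = 1 / sqrt (real N)"
  have \<delta>: "0 < \<delta>" "\<delta> \<le> cmod z"
    using N z by (auto simp: \<delta>_def)
  then have z0: "z \<noteq> 0" by auto
  have q: "q \<in> S" "q \<in> gauss" "q \<noteq> 0" "cmod q \<le> sqrt (real Q)" and a: "a \<in> gauss" "gcoprime a q"
    using qa S by (auto simp: fractions_near_def)
  define w where "w = a / q - b / r - z"
  have w: "cmod w \<le> \<delta>"
    using qa by (simp add: fractions_near_def w_def \<delta>_def algebra_simps)
  obtain t r' q' where t: "t \<in> D" "t \<noteq> 0" "r' \<in> gauss" "q' \<in> gauss" "r = t * r'" "q = t * q'" "gcoprime r' q'"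
    using divisor_system_gcd[OF D r q(2)] by metis
  have t_gauss: "t \<in> gauss"
    using t(1) divisor_system_subset(1)[OF D r(2)] by auto
  define m where "m = a * r' - b * q'"
  have tm: "t * m = a * r - b * q"
    by (simp add: m_def t algebra_simps)
  have rt: "r / t = r'"
    using t by simp
  have r'_dvd: "gdvd r' r"
    using t t_gauss by (intro gdvdI[of _ t]) (auto simp: mult.commute)
  have "a * r - b * q = r * q * (z + w)"
    using q(3) r(2) by (simp add: w_def field_simps)
  then have "t * m = t * (r * q' * (z + w))"
    unfolding tm by (simp add: t(6) mult_ac)
  then have m: "m = r * q' * (z + w)"
    using t(2) by simp
  have q'_le: "cmod q' \<le> sqrt (real Q) / cmod t"
    using q(4) t by (simp add: norm_mult field_simps)
  show ?thesis
  proof (rule that[of t q' m])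
    show "t \<in> D" "q = t * q'" using t by auto
    show "a = (t * m + b * q) / r" using tm r by simp
    show "m \<in> gauss" using a t b by (auto simp: m_def)
    have "m \<noteq> 0" using tm qa(2) by auto
    then show "0 < cmod m" by simp
    have "cmod m = cmod r * cmod q' * cmod (z + w)"
      by (simp add: m norm_mult)
    also have "\<dots> \<le> cmod r * (sqrt (real Q) / cmod t) * (3 * cmod z)"
      using q'_le w \<delta> norm_triangle_ineq[of z w] by (intro mult_mono) auto
    finally show "cmod m \<le> 3 * cmod (r * z) * sqrt (real Q) / cmod t"
      by (simp add: norm_mult mult_ac)
    show "gcoprime m (r / t)"
      unfolding rt gcoprime_def
    proof (intro allI impI)
      fix d assume d: "gdvd d m \<and> gdvd d r'"
      then have "gdvd d (a * r' - m)"
        using a by (intro gdvd_diff gdvd_mult_left) auto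
      then have "gdvd d (b * q')"
        by (simp add: m_def)
      moreover have "gcoprime d b"
        using gcoprime_dvd[OF gcoprime_sym[OF b(2)] _ gdvd_refl[OF b(1)]] gdvd_trans[OF _ r'_dvd] d by blast
      ultimately have "gdvd d q'"
        using b t gdvd_coprime_cancel by blast
      then show "gunit d"
        using t(7) d by (auto simp: gcoprime_def)
    qed
    show "q' \<in> Sdiv S t"
      using q t by (auto simp: Sdiv_def)
    have "m / (r * z) - q' = q' * w / z"
      using z0 r(2) by (simp add: m field_simps)
    then have "dist (m / (r * z)) q' = cmod q' * cmod w / cmod z"
      by (simp add: dist_norm norm_mult norm_divide)
    also have "\<dots> \<le> (sqrt (real Q) / cmod t) * \<delta> / cmod z"
      using q'_le w \<delta> by (intro divide_right_mono mult_mono) auto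
    finally show "q' \<in> cball (m / (r * z)) (sqrt (real Q) / (sqrt (real N) * cmod (z * t)))"
      by (simp add: \<delta>_def norm_mult mult_ac)
    have "q' - (- u * m) = (u * b + v * r) * q' - (- u * m)"
      by (simp add: uv)
    also have "\<dots> = r' * (v * t * q' + u * a)"
      by (simp add: m_def t(5) algebra_simps)
    finally show "gcong q' (- u * m) (r / t)"
      unfolding rt gcong_def using uv t a t_gauss by (intro gdvdI[of _ "v * t * q' + u * a"]) auto
  qed
qed

text \<open>\<open>h\<close> is minus an inverse of \<open>b\<close> modulo \<open>r\<close> and is
  fixed before \<open>z\<close>, so that one \<open>h\<close> serves all points around the same
  \<open>b / r\<close>.\<close>

lemma card_fractions_near_le:
  assumes S: "finite S" "S \<subseteq> cball 0 (sqrt (real Q)) \<inter> (gauss - {0})" and N: "0 < N"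
    and r: "r \<in> gauss" "r \<noteq> 0" and b: "b \<in> gauss" "gcoprime b r"
    and D: "divisor_system r D"
  obtains h where "h \<in> gauss" "gcoprime h r"
    "\<forall>z. 1 / sqrt (real N) \<le> cmod z \<longrightarrow>
       finite (fractions_near S (b / r + z) (1 / sqrt (real N))) \<and>
       real (card (fractions_near S (b / r + z) (1 / sqrt (real N)))) \<le> 4 + local_count Q N S D r z h"
proof -
  obtain u v where uv: "u \<in> gauss" "v \<in> gauss" "u * b + v * r = 1"
    using gauss_bezout[OF b(1) r(1) b(2)] by metis
  have cop: "gcoprime (- u) r"
    unfolding gcoprime_def
  proof (intro allI impI)
    fix d assume d: "gdvd d (- u) \<and> gdvd d r"
    then have "gdvd d (v * r - b * (- u))"
      using b uv by (intro gdvd_diff gdvd_mult_left) auto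
    then show "gunit d"
      using uv(3) by (simp add: gunit_def algebra_simps)
  qed
  have main: "finite (fractions_near S (b / r + z) (1 / sqrt (real N))) \<and>
      real (card (fractions_near S (b / r + z) (1 / sqrt (real N)))) \<le> 4 + local_count Q N S D r z (- u)"
    if z: "1 / sqrt (real N) \<le> cmod z" for z
  proof -
    let ?P = "fractions_near S (b / r + z) (1 / sqrt (real N))"
    define Ms where "Ms t = {m\<in>gauss. 0 < cmod m \<and>
        cmod m \<le> 3 * cmod (r * z) * sqrt (real Q) / cmod t \<and> gcoprime m (r / t)}" for t
    define E where "E t m = {q \<in> Sdiv S t \<inter> cball (m / (r * z)) (sqrt (real Q) / (sqrt (real N) * cmod (z * t))).
        gcong q (- u * m) (r / t)}" for t m
    define X where "X = (SIGMA t:D. SIGMA m:Ms t. E t m)"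
    define U where "U = (\<lambda>u. (u * r, u * b)) ` {u. gunit u}"
    \<comment> \<open>The pair \<open>(q, a)\<close> is recovered from \<open>t\<close>,
      \<open>m\<close> and \<open>q'\<close>, so the pairs are at most as many as the
      triples.\<close>
    define V where "V = (\<lambda>(t, m, q'). (t * q', (t * m + b * (t * q')) / r)) ` X"
    have D': "finite D" "0 \<notin> D"
      using divisor_system_subset[OF D r(2)] finite_subset finite_gauss_norm_le by blast+
    have finMs: "finite (Ms t)" for t
      by (rule finite_subset[OF _ finite_gauss_norm_le[of "3 * cmod (r * z) * sqrt (real Q) / cmod t"]])
        (auto simp: Ms_def)
    have finE: "finite (E t m)" if "t \<in> D" for t m
    proof -
      have "t \<noteq> 0" using that D'(2) by auto
      then show ?thesis
        using card_Sdiv(1)[OF S(1)] by (auto simp: E_def)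
    qed
    have finX: "finite X"
      unfolding X_def using D'(1) finMs finE by (intro finite_SigmaI) auto
    have sub: "?P \<subseteq> U \<union> V"
    proof
      fix p assume "p \<in> ?P"
      then obtain q a where p: "p = (q, a)" "(q, a) \<in> ?P" by (cases p) auto
      show "p \<in> U \<union> V"
      proof (cases "a * r = b * q")
        case True
        have "p \<in> U"
          unfolding p(1) U_def using p(2) S(2)
          by (intro fractions_equal_subset[OF r b _ _ _ _ True]) (auto simp: fractions_near_def)
        then show ?thesis by simp
      next
        case False
        obtain t m q' where *: "t \<in> D" "q = t * q'" "a = (t * m + b * q) / r"
          "m \<in> gauss" "0 < cmod m" "cmod m \<le> 3 * cmod (r * z) * sqrt (real Q) / cmod t" "gcoprime m (r / t)"
          "q' \<in> Sdiv S t" "q' \<in> cball (m / (r * z)) (sqrt (real Q) / (sqrt (real N) * cmod (z * t)))"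
          "gcong q' (- u * m) (r / t)"
          by (rule fraction_parametrisation[OF S(2) N r b uv D z p(2) False])
        have "(t, m, q') \<in> X"
          unfolding X_def Ms_def E_def using * by blast
        then have "p \<in> V"
          unfolding V_def p(1) *(3) using *(2) by (intro image_eqI[of _ _ "(t, m, q')"]) auto
        then show ?thesis by simp
      qed
    qed
    have finUV: "finite (U \<union> V)"
      unfolding U_def V_def using finX card_gunits(1) by auto
    have "card ?P \<le> card (U \<union> V)"
      using sub finUV by (rule card_mono[rotated])
    also have "\<dots> \<le> card U + card V"
      by (rule card_Un_le)
    also have "\<dots> \<le> 4 + card X"
      unfolding U_def V_def
      using card_image_le[OF card_gunits(1)] card_gunits(2) card_image_le[OF finX]
      by (intro add_mono order_trans[OF _ card_gunits(2)]) auto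
    finally have "real (card ?P) \<le> 4 + real (card X)"
      by linarith
    also have "card X = (\<Sum>t\<in>D. card (SIGMA m:Ms t. E t m))"
      unfolding X_def using D'(1) finMs finE by (intro card_SigmaI) auto
    also have "\<dots> = (\<Sum>t\<in>D. \<Sum>m\<in>Ms t. card (E t m))"
      using finMs finE by (intro sum.cong card_SigmaI) auto
    also have "real (\<Sum>t\<in>D. \<Sum>m\<in>Ms t. card (E t m)) = (\<Sum>t\<in>D. \<Sum>m\<in>Ms t. real (card (E t m)))"
      by simp
    also have "\<dots> \<le> local_count Q N S D r z (- u)"
      unfolding local_count_def Ms_def[symmetric]
    proof (intro sum_mono)
      fix t m assume "t \<in> D"
      then have "t \<noteq> 0" using D'(2) by auto
      then show "real (card (E t m))
        \<le> A_cnt Q S t (sqrt (real Q) / (sqrt (real N) * cmod (z * t))) (r / t) (- u * m)"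
        unfolding E_def using S by (intro card_le_A_cnt) auto
    qed
    finally show ?thesis
      using finite_subset[OF sub finUV] by simp
  qed
  show ?thesis
    using that[of "- u"] uv(1) cop main by blast
qed

section \<open>Nonnegativity and boundedness of the counts under the suprema\<close>

lemma nested_SUP:
  fixes F :: "'a \<Rightarrow> 'b \<Rightarrow> 'c \<Rightarrow> real"
  assumes le: "\<And>x y z. x \<in> A \<Longrightarrow> y \<in> B x \<Longrightarrow> z \<in> C x \<Longrightarrow> F x y z \<le> M"
    and ne: "\<And>x. x \<in> A \<Longrightarrow> B x \<noteq> {}" "\<And>x. x \<in> A \<Longrightarrow> C x \<noteq> {}"
    and mem: "x \<in> A" "y \<in> B x" "z \<in> C x"
  shows "F x y z \<le> (SUP x\<in>A. SUP y\<in>B x. SUP z\<in>C x. F x y z)"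
proof -
  \<comment> \<open>Nonempty index sets let the common bound \<open>M\<close> pass outwards, so that
    every level is a supremum of a bounded family.\<close>
  have 1: "(SUP z\<in>C x. F x y z) \<le> M" if "x \<in> A" "y \<in> B x" for x y
    by (rule cSUP_least[OF ne(2)[OF that(1)]]) (rule le[OF that])
  have 2: "(SUP y\<in>B x. SUP z\<in>C x. F x y z) \<le> M" if "x \<in> A" for x
    by (rule cSUP_least[OF ne(1)[OF that]]) (rule 1[OF that])
  have "F x y z \<le> (SUP z\<in>C x. F x y z)"
    by (rule cSUP_upper[OF mem(3)]) (rule bdd_aboveI2, rule le[OF mem(1,2)])
  also have "\<dots> \<le> (SUP y\<in>B x. SUP z\<in>C x. F x y z)"
    by (rule cSUP_upper[OF mem(2)]) (rule bdd_aboveI2, rule 1[OF mem(1)])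
  also have "\<dots> \<le> (SUP x\<in>A. SUP y\<in>B x. SUP z\<in>C x. F x y z)"
    by (rule cSUP_upper[OF mem(1)]) (rule bdd_aboveI2, rule 2)
  finally show ?thesis .
qed

lemma local_count_nonneg:
  assumes "finite S" "S \<subseteq> cball 0 (sqrt (real Q))" "divisor_system r D" "r \<noteq> 0"
  shows "0 \<le> local_count Q N S D r z h"
  unfolding local_count_def
  using divisor_system_subset(2)[OF assms(3,4)] assms(1,2)
  by (intro sum_nonneg A_cnt_nonneg) auto

text \<open>Once \<open>|r|\<close> and \<open>|r * z|\<close> are bounded, \<open>t\<close> and
  \<open>m\<close> range over fixed finite sets and each \<open>A_cnt\<close> is at most
  \<open>card S\<close>. The size of the bound is irrelevant; it only makes the suprema
  meaningful.\<close>

lemma local_count_bounded: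
  assumes S: "finite S" "S \<subseteq> cball 0 (sqrt (real Q))"
  obtains M where "\<And>D r z h. r \<noteq> 0 \<Longrightarrow> divisor_system r D \<Longrightarrow> cmod r \<le> B \<Longrightarrow> cmod (r * z) \<le> B \<Longrightarrow>
    local_count Q N S D r z h \<le> M"
proof
  define G1 where "G1 = {t \<in> gauss. cmod t \<le> B}"
  define G2 where "G2 = {t \<in> gauss. cmod t \<le> 3 * B * sqrt (real Q)}"
  fix D r z h
  assume r: "r \<noteq> 0" "cmod r \<le> B" and rz: "cmod (r * z) \<le> B" and D: "divisor_system r D"
  have D1: "D \<subseteq> G1" and D0: "0 \<notin> D"
    using divisor_system_subset[OF D r(1)] r(2) by (auto simp: G1_def)
  have fin: "finite G1" "finite G2"
    unfolding G1_def G2_def by (rule finite_gauss_norm_le)+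
  have m: "3 * cmod (r * z) * sqrt (real Q) / cmod t \<le> 3 * B * sqrt (real Q)" if "t \<in> D" for t
  proof -
    have "1 \<le> cmod t"
      using that D1 D0 gauss_norm_ge_1 by (auto simp: G1_def)
    then have "3 * cmod (r * z) * sqrt (real Q) / cmod t \<le> 3 * cmod (r * z) * sqrt (real Q) / 1"
      by (intro divide_left_mono) auto
    also have "\<dots> \<le> 3 * B * sqrt (real Q)"
      using rz by (simp add: mult_right_mono)
    finally show ?thesis .
  qed
  have inner: "(\<Sum>m\<in>{m\<in>gauss. 0 < cmod m \<and>
        cmod m \<le> 3 * cmod (r * z) * sqrt (real Q) / cmod t \<and> gcoprime m (r / t)}.
      A_cnt Q S t (sqrt (real Q) / (sqrt (real N) * cmod (z * t))) (r / t) (h * m))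
    \<le> real (card G2) * real (card S)" if t: "t \<in> D" for t
  proof (rule order_trans[OF sum_bounded_above mult_right_mono])
    show "A_cnt Q S t (sqrt (real Q) / (sqrt (real N) * cmod (z * t))) (r / t) (h * m) \<le> real (card S)" for m
      using t D0 by (intro A_cnt_bounds(2)[OF S(1)]) auto
    have "card {m\<in>gauss. 0 < cmod m \<and>
        cmod m \<le> 3 * cmod (r * z) * sqrt (real Q) / cmod t \<and> gcoprime m (r / t)} \<le> card G2"
      using m[OF t] fin(2) by (intro card_mono) (auto simp: G2_def)
    then show "real (card {m\<in>gauss. 0 < cmod m \<and>
        cmod m \<le> 3 * cmod (r * z) * sqrt (real Q) / cmod t \<and> gcoprime m (r / t)}) \<le> real (card G2)"
      by simp
  qed simp
  have "local_count Q N S D r z h \<le> real (card D) * (real (card G2) * real (card S))"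
    unfolding local_count_def by (rule sum_bounded_above) (rule inner)
  also have "\<dots> \<le> real (card G1) * (real (card G2) * real (card S))"
    using D1 fin by (intro mult_right_mono) (auto intro: card_mono)
  finally show "local_count Q N S D r z h \<le> real (card G1) * (real (card G2) * real (card S))" .
qed

section \<open>Arbitrary centres\<close>

lemma disc_cover:
  assumes "0 \<le> \<delta>" "cmod w \<le> sqrt 2 * \<delta>"
  obtains u where "u \<in> {1, -1, \<i>, -\<i>}" "cmod (w - u * of_real \<delta>) \<le> \<delta>"
proof -
  \<comment> \<open>\<open>w\<close> lies in the disc around \<open>u * \<delta>\<close> iff
    \<open>|w|^2 \<le> 2 * \<delta> * Re (w * cnj u)\<close>. The best unit \<open>u\<close> gives
    \<open>Re (w * cnj u) = M\<close>, and \<open>|w|^2\<close> is at most both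
    \<open>2 * M^2\<close> and \<open>2 * \<delta>^2\<close>, hence at most
    \<open>2 * \<delta> * M\<close>.\<close>
  define M where "M = max \<bar>Re w\<bar> \<bar>Im w\<bar>"
  have "(cmod w)\<^sup>2 \<le> 2 * (\<delta> * M)"
  proof (cases "M \<le> \<delta>")
    case True
    have "(Re w)\<^sup>2 \<le> M\<^sup>2" "(Im w)\<^sup>2 \<le> M\<^sup>2"
      using power_mono[of "\<bar>Re w\<bar>" M 2] power_mono[of "\<bar>Im w\<bar>" M 2] by (auto simp: M_def)
    moreover have "M\<^sup>2 \<le> \<delta> * M"
      using True by (simp add: power2_eq_square mult_right_mono M_def)
    ultimately show ?thesis
      by (simp add: cmod_power2)
  next
    case False
    have "(cmod w)\<^sup>2 \<le> (sqrt 2 * \<delta>)\<^sup>2"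
      using assms(2) by (rule power_mono) simp
    also have "\<dots> = 2 * (\<delta> * \<delta>)"
      by (simp add: power_mult_distrib power2_eq_square)
    also have "\<dots> \<le> 2 * (\<delta> * M)"
      using False assms(1) by (intro mult_left_mono) auto
    finally show ?thesis .
  qed
  moreover have "M \<in> {Re w, - Re w, Im w, - Im w}"
    by (auto simp: M_def max_def abs_if)
  ultimately consider "(cmod w)\<^sup>2 \<le> 2 * (\<delta> * Re w)" | "(cmod w)\<^sup>2 \<le> 2 * (\<delta> * (- Re w))"
    | "(cmod w)\<^sup>2 \<le> 2 * (\<delta> * Im w)" | "(cmod w)\<^sup>2 \<le> 2 * (\<delta> * (- Im w))"
    by auto
  then have "\<exists>u\<in>{1, -1, \<i>, -\<i>}. (cmod w)\<^sup>2 \<le> 2 * (\<delta> * Re (w * cnj u))"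
    by cases auto
  then obtain u where u: "u \<in> {1, -1, \<i>, -\<i>}" "(cmod w)\<^sup>2 \<le> 2 * (\<delta> * Re (w * cnj u))"
    by blast
  have "(cmod (w - u * of_real \<delta>))\<^sup>2 = (cmod w)\<^sup>2 - 2 * (\<delta> * Re (w * cnj u)) + \<delta>\<^sup>2"
    unfolding cmod_power2 using u(1) by (auto simp: power2_eq_square algebra_simps)
  also have "\<dots> \<le> \<delta>\<^sup>2"
    using u(2) by simp
  finally have "cmod (w - u * of_real \<delta>) \<le> \<delta>"
    using assms(1) by (rule power2_le_imp_le)
  then show ?thesis
    using that u(1) by blast
qed

lemma fractions_near_mono:
  assumes "cmod (\<alpha> - \<beta>) + \<rho> \<le> \<sigma>"
  shows "fractions_near S \<alpha> \<rho> \<subseteq> fractions_near S \<beta> \<sigma>"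
proof -
  have "cmod (a / q - \<beta>) \<le> \<sigma>" if "cmod (a / q - \<alpha>) \<le> \<rho>" for a q
    using norm_triangle_ineq[of "a / q - \<alpha>" "\<alpha> - \<beta>"] that assms by simp
  then show ?thesis
    by (auto simp: fractions_near_def)
qed

lemma card_fractions_near_uniform:
  assumes S: "finite S" "S \<subseteq> cball 0 (sqrt (real Q)) \<inter> (gauss - {0})" and N: "0 < N"
    and D: "\<And>r. r \<in> gauss - {0} \<Longrightarrow> divisor_system r (D r)"
    and M: "\<And>r z h. r \<in> gauss - {0} \<Longrightarrow> cmod r \<le> real N powr (1/4) \<Longrightarrow> 1 / sqrt (real N) \<le> cmod z \<Longrightarrow>
      cmod z \<le> 2 / (cmod r * real N powr (1/4)) \<Longrightarrow> h \<in> gauss \<Longrightarrow> gcoprime h r \<Longrightarrow>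
      local_count Q N S (D r) r z h \<le> M"
    and M0: "0 \<le> M" and \<rho>: "\<rho> \<le> (2/5) / sqrt (real N)"
  shows "finite (fractions_near S \<alpha> \<rho>)" "real (card (fractions_near S \<alpha> \<rho>)) \<le> 16 + 4 * M"
proof -
  define T where "T = real N powr (1/4)"
  define \<delta> where "\<delta> = 1 / sqrt (real N)"
  have T: "1 \<le> T"
    using N by (simp add: T_def ge_one_powr_ge_zero)
  have T2: "T * T = sqrt (real N)"
    using N by (simp add: T_def powr_add[symmetric] powr_half_sqrt)
  have \<delta>: "0 < \<delta>" using N by (simp add: \<delta>_def)
  have \<rho>': "\<rho> \<le> 2/5 * \<delta>" using \<rho> by (simp add: \<delta>_def)
  obtain r b where r: "r \<in> gauss" "b \<in> gauss" "r \<noteq> 0" "gcoprime b r" "cmod r \<le> T"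
    and z: "cmod (\<alpha> - b / r) \<le> 2 / (cmod r * T)"
    by (rule gauss_dirichlet_coprime[OF T])
  have Dr: "divisor_system r (D r)" using D r by auto
  obtain h where h: "h \<in> gauss" "gcoprime h r"
    and near: "\<forall>z. \<delta> \<le> cmod z \<longrightarrow> finite (fractions_near S (b / r + z) \<delta>) \<and>
       real (card (fractions_near S (b / r + z) \<delta>)) \<le> 4 + local_count Q N S (D r) r z h"
    by (rule card_fractions_near_le[OF S N r(1,3,2,4) Dr, folded \<delta>_def])
  have fin: "finite (fractions_near S (b / r + z) \<delta>)" if "\<delta> \<le> cmod z" for z
    using near that by blast
  have card': "real (card (fractions_near S (b / r + z) \<delta>)) \<le> 4 + M"
    if "\<delta> \<le> cmod z" "cmod z \<le> 2 / (cmod r * T)" for z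
    using near M[of r z h] that r h by (fastforce simp: T_def \<delta>_def)
  have "finite (fractions_near S \<alpha> \<rho>) \<and> real (card (fractions_near S \<alpha> \<rho>)) \<le> 16 + 4 * M"
  proof (cases "\<delta> \<le> cmod (\<alpha> - b / r)")
    case True
    have sub: "fractions_near S \<alpha> \<rho> \<subseteq> fractions_near S (b / r + (\<alpha> - b / r)) \<delta>"
      using \<rho>' \<delta> by (intro fractions_near_mono) simp
    then have "card (fractions_near S \<alpha> \<rho>) \<le> card (fractions_near S (b / r + (\<alpha> - b / r)) \<delta>)"
      using fin[OF True] by (intro card_mono)
    then show ?thesis
      using card'[OF True z] finite_subset[OF sub fin[OF True]] M0 by linarith
  next
    case False
    let ?U = "{1, -1, \<i>, -\<i>}"
    let ?F = "\<lambda>u. fractions_near S (b / r + u * of_real \<delta>) \<delta>"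
    have u: "cmod (u * of_real \<delta>) = \<delta>" if "u \<in> ?U" for u
      using that \<delta> by (auto simp: norm_mult)
    \<comment> \<open>Since \<open>\<delta> = 1 / T^2\<close>, the bound \<open>|r| \<le> T\<close>
      puts the circle of radius \<open>\<delta>\<close> inside the admissible range of
      \<open>z\<close>.\<close>
    have "cmod r * T \<le> T * T"
      using r(5) T by (intro mult_right_mono) auto
    then have "1 / (T * T) \<le> 2 / (cmod r * T)"
      using r(3) T by (intro frac_le) auto
    then have \<delta>_le: "\<delta> \<le> 2 / (cmod r * T)"
      unfolding T2 \<delta>_def .
    \<comment> \<open>The fractions lie within \<open>\<delta> + \<rho> \<le> 7/5 * \<delta>\<close>
      of \<open>b / r\<close>, and the four discs cover radius \<open>sqrt 2 * \<delta>\<close>.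
      This is the origin of the constant 2/5.\<close>
    have "(7/5)\<^sup>2 \<le> (2::real)"
      by (simp add: power2_eq_square)
    then have "7/5 \<le> sqrt (2::real)"
      by (rule real_le_rsqrt)
    then have 75: "7/5 * \<delta> \<le> sqrt 2 * \<delta>"
      using \<delta> by (intro mult_right_mono) auto
    have sub: "fractions_near S \<alpha> \<rho> \<subseteq> (\<Union>u\<in>?U. ?F u)"
    proof
      fix p assume p: "p \<in> fractions_near S \<alpha> \<rho>"
      moreover have "fractions_near S \<alpha> \<rho> \<subseteq> fractions_near S (b / r) (sqrt 2 * \<delta>)"
        using \<rho>' False 75 by (intro fractions_near_mono) linarith
      ultimately obtain q a where qa: "p = (q, a)" "cmod (a / q - b / r) \<le> sqrt 2 * \<delta>"
        by (auto simp: fractions_near_def)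
      obtain u where "u \<in> ?U" "cmod (a / q - b / r - u * of_real \<delta>) \<le> \<delta>"
        by (rule disc_cover[OF less_imp_le[OF \<delta>] qa(2)])
      then show "p \<in> (\<Union>u\<in>?U. ?F u)"
        using p unfolding qa(1) fractions_near_def by (intro UN_I[of u]) (auto simp: diff_diff_eq)
    qed
    have finF: "finite (?F u)" if "u \<in> ?U" for u
      using fin[of "u * of_real \<delta>"] u[OF that] by simp
    then have finU: "finite (\<Union>u\<in>?U. ?F u)"
      by (intro finite_UN_I) simp_all
    have "card (fractions_near S \<alpha> \<rho>) \<le> card (\<Union>u\<in>?U. ?F u)"
      using sub finU by (rule card_mono[rotated])
    also have "\<dots> \<le> (\<Sum>u\<in>?U. card (?F u))"
      by (rule card_UN_le) simp
    finally have "real (card (fractions_near S \<alpha> \<rho>)) \<le> real (\<Sum>u\<in>?U. card (?F u))"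
      by (rule of_nat_mono)
    also have "\<dots> = (\<Sum>u\<in>?U. real (card (?F u)))"
      by simp
    also have "\<dots> \<le> real (card ?U) * (4 + M)"
      using card' u \<delta>_le by (intro sum_bounded_above) simp
    also have "\<dots> \<le> 4 * (4 + M)"
      using M0 by (intro mult_right_mono) (auto simp: card_insert_if)
    finally show ?thesis
      using finite_subset[OF sub finU] by simp
  qed
  then show "finite (fractions_near S \<alpha> \<rho>)" "real (card (fractions_near S \<alpha> \<rho>)) \<le> 16 + 4 * M"
    by auto
qed

text \<open>Passage from the torus to the plane: a numerator is shifted by a multiple of
  \<open>q\<close> that moves its fraction into the disc. Shifts preserve the class modulo
  \<open>q\<close>, and \<open>R q\<close> has one member per class, so nothing is
  identified.\<close>

lemma card_reduced_fractions_le: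
  assumes S: "finite S" "S \<subseteq> gauss - {0}"
    and R: "\<And>q. q \<in> S \<Longrightarrow> reduced_residue_system q (R q)"
    and fin: "finite (fractions_near S \<alpha> \<rho>)"
  shows "card {l \<in> Sigma S R. \<exists>g\<in>gauss. cmod (snd l / fst l - g - \<alpha>) \<le> \<rho>} \<le> card (fractions_near S \<alpha> \<rho>)"
    (is "card ?L \<le> _")
proof -
  define g where "g l = (SOME g. g \<in> gauss \<and> cmod (snd l / fst l - g - \<alpha>) \<le> \<rho>)" for l
  have g: "g l \<in> gauss \<and> cmod (snd l / fst l - g l - \<alpha>) \<le> \<rho>" if "l \<in> ?L" for l
    unfolding g_def by (rule someI_ex) (use that in auto)
  define f where "f l = (fst l, snd l - g l * fst l)" for l
  show ?thesis
  proof (rule card_inj_on_le[OF _ _ fin])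
    show "inj_on f ?L"
    proof (rule inj_onI)
      fix l l' assume l: "l \<in> ?L" "l' \<in> ?L" and eq: "f l = f l'"
      obtain q b b' where l_eq: "l = (q, b)" "l' = (q, b')"
        using eq by (cases l; cases l') (auto simp: f_def)
      have qb: "q \<in> S" "b \<in> R q" "b' \<in> R q"
        using l by (auto simp: l_eq)
      have "b - b' = q * (g l - g l')"
        using eq by (simp add: f_def l_eq algebra_simps)
      then have "gcong b b' q"
        unfolding gcong_def using g[OF l(1)] g[OF l(2)] S qb by (intro gdvdI[of _ "g l - g l'"]) auto
      then show "l = l'"
        using R[OF qb(1)] qb by (auto simp: reduced_residue_system_def l_eq)
    qed
    show "f ` ?L \<subseteq> fractions_near S \<alpha> \<rho>"
    proof
      fix p assume "p \<in> f ` ?L"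
      then obtain l where l: "l \<in> ?L" "p = f l" by blast
      obtain q b where l_eq: "l = (q, b)" by (cases l)
      have qb: "q \<in> S" "b \<in> R q" using l by (auto simp: l_eq)
      have q: "q \<in> gauss" "q \<noteq> 0" using S qb by auto
      have b: "b \<in> gauss" "gcoprime b q"
        using R[OF qb(1)] qb(2) by (auto simp: reduced_residue_system_def)
      have g': "g l \<in> gauss" "cmod (b / q - g l - \<alpha>) \<le> \<rho>"
        using g[OF l(1)] by (auto simp: l_eq)
      have "(b - g l * q) / q = b / q - g l"
        using q(2) by (simp add: field_simps)
      then show "p \<in> fractions_near S \<alpha> \<rho>"
        using g' qb q b gcoprime_shift[OF b(2,1) q(1) g'(1)]
        by (auto simp: l(2) f_def l_eq fractions_near_def)
    qed
  qed
qed

lemma norm_le_Ints: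
  assumes "x \<in> \<int>" "x\<^sup>2 \<le> real N"
  shows "\<bar>x\<bar> \<le> real (nat \<lfloor>sqrt (real N)\<rfloor>)"
proof -
  obtain k where k: "x = of_int k" using assms(1) by (auto elim: Ints_cases)
  have "\<bar>x\<bar> \<le> sqrt (real N)"
    using assms(2) by (simp add: real_le_rsqrt)
  then have "\<bar>k\<bar> \<le> \<lfloor>sqrt (real N)\<rfloor>"
    by (simp add: le_floor_iff k)
  then show ?thesis
    by (simp add: k)
qed

theorem theorem1:
  shows "\<exists>c1>0. \<forall>(Q::nat) (N::nat) (a::complex \<Rightarrow> complex) (S::complex set)
            (R::complex \<Rightarrow> complex set) (Dv::complex \<Rightarrow> complex set).
    N \<ge> 1 \<longrightarrow>
    S \<subseteq> cball 0 (sqrt (real Q)) \<inter> (gauss - {0}) \<longrightarrow>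
    (\<forall>q\<in>S. reduced_residue_system q (R q)) \<longrightarrow>
    (\<forall>r\<in>gauss - {0}. divisor_system r (Dv r)) \<longrightarrow>
    (\<Sum>q\<in>S. \<Sum>b\<in>R q.
        (cmod (\<Sum>n\<in>{n\<in>gauss. gnorm n \<le> real N}. a n * e (Re (n * b / q))))^2)
    \<le> c1 * real N * (\<Sum>n\<in>{n\<in>gauss. gnorm n \<le> real N}. (cmod (a n))^2) *
       (1 + (SUP r\<in>{r\<in>gauss - {0}. 1 \<le> cmod r \<and> cmod r \<le> real N powr (1/4)}.
              SUP z\<in>{z. real N powr (-1/2) \<le> cmod z \<and>
                        cmod z \<le> 2 / (cmod r * real N powr (1/4))}.
                SUP h\<in>{h\<in>gauss. gcoprime h r}.
                  (\<Sum>t\<in>Dv r.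
                     \<Sum>m\<in>{m\<in>gauss. 0 < cmod m \<and>
                            cmod m \<le> 3 * cmod (r * z) * sqrt (real Q) / cmod t \<and>
                            gcoprime m (r / t)}.
                       A_cnt Q S t (sqrt (real Q) / (sqrt (real N) * cmod (z * t))) (r / t) (h * m))))"
proof (intro exI[of _ "36864 :: real"] conjI allI impI)
  show "(36864 :: real) > 0" by simp
next
  fix Q N :: nat and a :: "complex \<Rightarrow> complex" and S :: "complex set"
    and R Dv :: "complex \<Rightarrow> complex set"
  assume N: "N \<ge> 1" and S: "S \<subseteq> cball 0 (sqrt (real Q)) \<inter> (gauss - {0})"
    and R: "\<forall>q\<in>S. reduced_residue_system q (R q)"
    and D: "\<forall>r\<in>gauss - {0}. divisor_system r (Dv r)"
  define Rs where "Rs = {r\<in>gauss - {0}. 1 \<le> cmod r \<and> cmod r \<le> real N powr (1/4)}"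
  define Zs where "Zs r = {z. real N powr (-1/2) \<le> cmod z \<and> cmod z \<le> 2 / (cmod r * real N powr (1/4))}" for r
  define Hs where "Hs r = {h\<in>gauss. gcoprime h r}" for r
  define M where "M = (SUP r\<in>Rs. SUP z\<in>Zs r. SUP h\<in>Hs r. local_count Q N S (Dv r) r z h)"
  define B where "B = {n\<in>gauss. gnorm n \<le> real N}"
  define Z where "Z = (\<Sum>n\<in>B. (cmod (a n))\<^sup>2)"
  define s where "s = nat \<lfloor>sqrt (real N)\<rfloor>"
  define \<rho> where "\<rho> = 3 / (4 * real (4 * s))"
  have finS: "finite S"
    using S by (intro finite_subset[OF _ finite_gauss_norm_le[of "sqrt (real Q)"]]) auto
  have sqrtN: "1 \<le> sqrt (real N)" using N by simp
  have T: "1 \<le> real N powr (1/4)"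
    using N by (simp add: ge_one_powr_ge_zero)
  have T2: "real N powr (1/4) * real N powr (1/4) = sqrt (real N)"
    using N by (simp add: powr_add[symmetric] powr_half_sqrt)
  have half: "real N powr - (1/2) = 1 / sqrt (real N)"
    using N powr_minus_divide[of "real N" "1/2"] by (simp add: powr_half_sqrt)
  have s: "1 \<le> s" "real s \<le> sqrt (real N)" "sqrt (real N) < real s + 1"
    using sqrtN unfolding s_def by linarith+
  have s2: "(real s)\<^sup>2 \<le> real N"
    using power_mono[OF s(2), of 2] by simp
  have Zs_ne: "Zs r \<noteq> {}" if "r \<in> Rs" for r
  proof -
    have "cmod r * real N powr (1/4) \<le> sqrt (real N)"
      using that T unfolding Rs_def T2[symmetric] by (intro mult_right_mono) auto
    moreover have "0 < cmod r * real N powr (1/4)"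
      using that N by (auto simp: Rs_def)
    ultimately have "1 / sqrt (real N) \<le> 2 / (cmod r * real N powr (1/4))"
      by (intro frac_le) auto
    then have "of_real (1 / sqrt (real N)) \<in> Zs r"
      by (simp add: Zs_def half norm_divide)
    then show ?thesis by blast
  qed
  have Hs_ne: "Hs r \<noteq> {}" for r
  proof -
    have "1 \<in> Hs r" by (auto simp: Hs_def gcoprime_def gunit_def)
    then show ?thesis by blast
  qed
  \<comment> \<open>With \<open>T = N^(1/4) \<ge> 1\<close> one has \<open>|r| \<le> T\<close> and
    \<open>|r * z| \<le> 2 / T\<close>, so \<open>2 * T\<close> dominates both.\<close>
  obtain C where C: "\<And>D r z h. r \<noteq> 0 \<Longrightarrow> divisor_system r D \<Longrightarrow> cmod r \<le> 2 * real N powr (1/4) \<Longrightarrow>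
    cmod (r * z) \<le> 2 * real N powr (1/4) \<Longrightarrow> local_count Q N S D r z h \<le> C"
    using local_count_bounded[OF finS, of Q "2 * real N powr (1/4)" N] S by blast
  have bounded: "local_count Q N S (Dv r) r z h \<le> C" if "r \<in> Rs" "z \<in> Zs r" "h \<in> Hs r" for r z h
  proof (rule C)
    show "r \<noteq> 0" "divisor_system r (Dv r)" "cmod r \<le> 2 * real N powr (1/4)"
      using that(1) D by (auto simp: Rs_def)
    have "cmod r * cmod z \<le> cmod r * (2 / (cmod r * real N powr (1/4)))"
      using that(2) by (intro mult_left_mono) (auto simp: Zs_def)
    also have "\<dots> = 2 / real N powr (1/4)"
      using \<open>r \<noteq> 0\<close> by simp
    also have "\<dots> \<le> 2 * real N powr (1/4)"
      using T sqrtN by (simp add: divide_le_eq mult.assoc T2)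
    finally show "cmod (r * z) \<le> 2 * real N powr (1/4)"
      by (simp add: norm_mult)
  qed
  have le_M: "local_count Q N S (Dv r) r z h \<le> M" if "r \<in> Rs" "z \<in> Zs r" "h \<in> Hs r" for r z h
    unfolding M_def using bounded Zs_ne Hs_ne that by (rule nested_SUP)
  \<comment> \<open>A real supremum inherits nonnegativity only through a member of the family;
    \<open>r = 1\<close> always provides one.\<close>
  have M0: "0 \<le> M"
  proof -
    have r: "1 \<in> Rs" using T by (simp add: Rs_def)
    obtain z where z: "z \<in> Zs 1" using Zs_ne[OF r] by blast
    obtain h where h: "h \<in> Hs 1" using Hs_ne by blast
    have "0 \<le> local_count Q N S (Dv 1) 1 z h"
      using S D by (intro local_count_nonneg finS) auto
    then show ?thesis using le_M[OF r z h] by linarith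
  qed
  have \<rho>: "\<rho> \<le> (2/5) / sqrt (real N)"
  proof -
    \<comment> \<open>This is \<open>3 / (16 * s) \<le> 2 / (5 * sqrt N)\<close> cleared of
      denominators. It holds because \<open>sqrt N < s + 1 \<le> 2 * s\<close>.\<close>
    have "15 * sqrt (real N) \<le> 32 * real s"
      using s(1,3) by linarith
    then show ?thesis
      using s(1) sqrtN by (simp add: \<rho>_def divide_le_eq le_divide_eq)
  qed
  have near: "finite (fractions_near S \<alpha> \<rho>)" "real (card (fractions_near S \<alpha> \<rho>)) \<le> 16 + 4 * M" for \<alpha>
  proof -
    have D': "divisor_system r (Dv r)" if "r \<in> gauss - {0}" for r
      using D that by blast
    have M': "local_count Q N S (Dv r) r z h \<le> M"
      if "r \<in> gauss - {0}" "cmod r \<le> real N powr (1/4)" "1 / sqrt (real N) \<le> cmod z"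
        "cmod z \<le> 2 / (cmod r * real N powr (1/4))" "h \<in> gauss" "gcoprime h r" for r z h
      using that gauss_norm_ge_1[of r] by (intro le_M) (auto simp: Rs_def Zs_def Hs_def half)
    have "0 < N" using N by simp
    from card_fractions_near_uniform[OF finS S this D' M' M0 \<rho>]
    show "finite (fractions_near S \<alpha> \<rho>)" "real (card (fractions_near S \<alpha> \<rho>)) \<le> 16 + 4 * M"
      by blast+
  qed
  have finR: "finite (R q)" if "q \<in> S" for q
    using finite_reduced_residue_system[of q "R q"] R S that by auto
  have finI: "finite (Sigma S R)"
    using finS finR by auto
  have count: "real (card {l \<in> Sigma S R. \<exists>g\<in>gauss. cmod (snd l / fst l - g - \<alpha>) \<le> 3 / (4 * real (4 * s))}) \<le> 16 + 4 * M" for \<alpha>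
  proof -
    have "card {l \<in> Sigma S R. \<exists>g\<in>gauss. cmod (snd l / fst l - g - \<alpha>) \<le> \<rho>} \<le> card (fractions_near S \<alpha> \<rho>)"
      using S R near(1) by (intro card_reduced_fractions_le finS) auto
    then show ?thesis
      using near(2)[of \<alpha>] unfolding \<rho>_def by linarith
  qed
  have B: "\<bar>Re n\<bar> \<le> real s \<and> \<bar>Im n\<bar> \<le> real s" if "n \<in> B" for n
  proof -
    have n: "Re n \<in> \<int>" "Im n \<in> \<int>" "(Re n)\<^sup>2 + (Im n)\<^sup>2 \<le> real N"
      using that by (auto simp: B_def gauss_def gnorm_def)
    then have "(Re n)\<^sup>2 \<le> real N" "(Im n)\<^sup>2 \<le> real N"
      using zero_le_power2[of "Re n"] zero_le_power2[of "Im n"] by linarith+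
    then show ?thesis
      using n(1,2) norm_le_Ints by (auto simp: s_def)
  qed
  have finB: "finite B"
    using real_le_rsqrt[of "cmod n" "real N" for n]
    by (intro finite_subset[OF _ finite_gauss_norm_le[of "sqrt (real N)"]])
      (auto simp: B_def gnorm_def cmod_power2)
  have "B \<subseteq> gauss" by (auto simp: B_def)
  have "(\<Sum>q\<in>S. \<Sum>b\<in>R q. (cmod (\<Sum>n\<in>B. a n * e (Re (n * b / q))))\<^sup>2)
    = (\<Sum>l\<in>Sigma S R. (cmod (\<Sum>n\<in>B. a n * e (Re (n * (snd l / fst l)))))\<^sup>2)"
    using finS finR by (subst sum.Sigma) (auto simp: case_prod_unfold)
  also have "\<dots> \<le> 2304 * (16 + 4 * M) * (real s)\<^sup>2 * Z"
    unfolding Z_def using s(1) by (intro large_sieve finI count \<open>B \<subseteq> gauss\<close> finB B) auto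
  \<comment> \<open>Raising 4 to 16 allows \<open>1 + M\<close> to be factored out, and
    \<open>2304 * 16 = 36864\<close>.\<close>
  also have "\<dots> \<le> 2304 * (16 + 16 * M) * real N * Z"
    using s2 M0 by (intro mult_right_mono mult_mono) (auto simp: Z_def intro!: sum_nonneg)
  also have "\<dots> = 36864 * real N * Z * (1 + M)"
    by (simp add: algebra_simps)
  finally show "(\<Sum>q\<in>S. \<Sum>b\<in>R q.
        (cmod (\<Sum>n\<in>{n\<in>gauss. gnorm n \<le> real N}. a n * e (Re (n * b / q))))^2)
    \<le> 36864 * real N * (\<Sum>n\<in>{n\<in>gauss. gnorm n \<le> real N}. (cmod (a n))^2) *
       (1 + (SUP r\<in>{r\<in>gauss - {0}. 1 \<le> cmod r \<and> cmod r \<le> real N powr (1/4)}.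
              SUP z\<in>{z. real N powr (-1/2) \<le> cmod z \<and>
                        cmod z \<le> 2 / (cmod r * real N powr (1/4))}.
                SUP h\<in>{h\<in>gauss. gcoprime h r}.
                  (\<Sum>t\<in>Dv r.
                     \<Sum>m\<in>{m\<in>gauss. 0 < cmod m \<and>
                            cmod m \<le> 3 * cmod (r * z) * sqrt (real Q) / cmod t \<and>
                            gcoprime m (r / t)}.
                       A_cnt Q S t (sqrt (real Q) / (sqrt (real N) * cmod (z * t))) (r / t) (h * m))))"
    unfolding B_def Z_def M_def Rs_def Zs_def Hs_def local_count_def .
qed

end
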